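(* There exists a nonadaptive algorithm that, given a real-valued array $A$ of length $n$ containing at most $r$ distinct values and with $|\mathrm{LIS}(A)|=\lambda\cdot n$, makes $\tilde{O}(\sqrt{r}\cdot\mathrm{poly}(1/\lambda))$ queries and outputs, with probability at least $2/3$, an estimate $\mathsf{est}$ such that $$\Omega(\lambda\cdot|\mathrm{LIS}(A)|)\;\le\;\mathsf{est}\;\le\;O(|\mathrm{LIS}(A)|).$$
   Context: The array $A$ is accessed through an oracle which, on query $i\in[n]=\{1,\dots,n\}$, returns $A[i]$. An algorithm (here randomized) is nonadaptive if its queries do not depend on the answers to its previous queries. $|\mathrm{LIS}(A)|$ denotes the length of a longest increasing subsequence of $A$, that is, the largest cardinality of a set $\mathcal{L}\subseteq[n]$ with $A[u]\le A[v]$ for all $u<v$ in $\mathcal{L}$ (nondecreasing subsequences are allowed). The parameter $r$ is a guaranteed upper bound on the number of distinct values in $A$. The notation $\tilde{O}(\cdot)$ suppresses polylogarithmic factors, $\mathrm{poly}(1/\lambda)$ is a fixed polynomial in $1/\lambda$, and the constants hidden in $\Omega(\cdot)$ and $O(\cdot)$ are absolute. *)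

theory Defs
  imports "HOL-Probability.Probability"
begin

text \<open>
  An array of length \<open>n\<close> is a function \<open>nat \<Rightarrow> real\<close> of which only the values on \<open>{1..n}\<close> matter.
\<close>

definition LIS :: "nat \<Rightarrow> (nat \<Rightarrow> real) \<Rightarrow> nat" where
  "LIS n A = Max {card L | L. L \<subseteq> {1..n} \<and> mono_on L A}"

text \<open>
  A deterministic nonadaptive algorithm fixes its whole list of queries before it sees any answer,
  and then computes its output from the list of answers. A randomized nonadaptive algorithm is a
  probability distribution over deterministic ones, so the queries and the post-processing may
  share randomness. As usual for query complexity, running time and computability are not modelled.
\<close>

datatype det_alg = Det_Alg (queries: "nat list") (post: "real list \<Rightarrow> real")

type_synonym nonadaptive_alg = "det_alg pmf"

definition run :: "det_alg \<Rightarrow> (nat \<Rightarrow> real) \<Rightarrow> real" where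
  "run D A = post D (map A (queries D))"

text \<open>
  A soft-O bound for \<open>x \<ge> 1\<close>, with leading constant \<open>K\<close> and logarithmic exponent \<open>k\<close>; the
  summand 1 only keeps the logarithmic factor positive at \<open>x = 1\<close>.
\<close>

definition soft_O :: "real \<Rightarrow> nat \<Rightarrow> real \<Rightarrow> real" where
  "soft_O K k x = K * x * (1 + ln x) ^ k"

text \<open>
  In the statement, \<open>lam0\<close> is the guaranteed lower bound on the ratio \<open>lam\<close> = LIS / n that the
  algorithm is given, just as \<open>r\<close> is a guaranteed upper bound on the number of distinct values.
  The choice \<open>lam0 = lam\<close> is allowed. The approximation guarantee is in terms of the actual ratio
  \<open>lam\<close>: if \<open>lam\<close> itself were an input, or if the guarantee used \<open>lam0\<close> in place of \<open>lam\<close>,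
  answering \<open>lam * n\<close> (respectively \<open>lam0 * n\<close>) without any query would do.
\<close>

end

theory Submission
  imports Defs
begin

text \<open>
  Cut the positions into about \<open>sqrt r\<close> columns. A staircase is a set of points in which the values
  in each column lie between two consecutive terms of a nondecreasing sequence of thresholds. Every
  increasing set is contained in a staircase, and the LISs of the columns of one staircase
  concatenate. There are few staircases, namely \<open>r\<close> to the power of about \<open>2 sqrt r\<close>, so
  \<open>sqrt r\<close> times \<open>poly(1/lam0)\<close> samples estimate the densities of all of them. Greedily pick
  staircases that cover the most uncovered samples. After \<open>k = 4/lam\<close> steps no staircase contains
  more than about \<open>n/k\<close> uncovered points, hence the chosen ones cover a constant fraction of the
  LIS and one of them contains a \<open>1/k\<close> share of it.

  For a fixed staircase, the sum of the LISs of its columns is estimated from a few random columns.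
  On average a column of a staircase contains at most about \<open>sqrt r\<close> distinct values, so in a typical
  column the LIS is, up to a small error, the largest size of a finer staircase with
  \<open>sqrt r * poly(1/lam0)\<close> cells, which again is found by sampling.
\<close>

section \<open>Concentration and expectation bounds\<close>

lemma hoeffding_Pi_pmf:
  fixes p :: "'a pmf" and f :: "'a \<Rightarrow> real"
  assumes f: "\<And>x. f x \<in> {0..1}" and "T > 0" "e \<ge> 0"
  shows "measure_pmf.prob (Pi_pmf {..<T} d (\<lambda>_. p))
           {x. \<bar>(\<Sum>j<T. f (x j)) / real T - measure_pmf.expectation p f\<bar> \<ge> e}
         \<le> 2 * exp (- 2 * real T * e\<^sup>2)"
proof -
  let ?P = "Pi_pmf {..<T} d (\<lambda>_. p)"
  have ind: "prob_space.indep_vars ?P (\<lambda>_. borel) (\<lambda>j x. f (x j)) {..<T}"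
    by (rule prob_space.indep_vars_compose2[OF prob_space_measure_pmf indep_vars_Pi_pmf]) auto
  interpret H: Hoeffding_ineq "measure_pmf ?P" "{..<T}" "\<lambda>j x. f (x j)" "\<lambda>_. 0" "\<lambda>_. 1"
     "\<Sum>j<T. measure_pmf.expectation ?P (\<lambda>x. f (x j))"
    using f by unfold_locales (auto intro: ind)
  have "measure_pmf.expectation ?P (\<lambda>x. f (x j)) = measure_pmf.expectation p f" if "j < T" for j
  proof -
    have "measure_pmf.expectation (map_pmf (\<lambda>x. x j) ?P) f = measure_pmf.expectation p f"
      using that by (subst Pi_pmf_component) auto
    then show ?thesis by simp
  qed
  then have mu: "(\<Sum>j<T. measure_pmf.expectation ?P (\<lambda>x. f (x j))) = real T * measure_pmf.expectation p f"
    by simp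
  have "{x. \<bar>(\<Sum>j<T. f (x j)) / real T - measure_pmf.expectation p f\<bar> \<ge> e}
      = {x \<in> space (measure_pmf ?P). \<bar>(\<Sum>j<T. f (x j)) - real T * measure_pmf.expectation p f\<bar> \<ge> real T * e}"
  proof -
    have "\<bar>(\<Sum>j<T. f (x j)) - real T * measure_pmf.expectation p f\<bar>
       = real T * \<bar>(\<Sum>j<T. f (x j)) / real T - measure_pmf.expectation p f\<bar>" for x
      using \<open>T > 0\<close> by (simp add: abs_mult_pos' right_diff_distrib)
    then show ?thesis using \<open>T > 0\<close> by simp
  qed
  with H.Hoeffding_ineq_abs_ge[of "real T * e"] show ?thesis
    using \<open>T > 0\<close> \<open>e \<ge> 0\<close> unfolding mu
    by (simp add: power_mult_distrib power2_eq_square mult.assoc mult.left_commute)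
qed

text \<open>A union bound over Hoeffding's inequality. Since it covers the whole family at once, a
  set may be selected after looking at the sample, as the greedy procedure does.\<close>

lemma uniform_convergence:
  fixes p :: "'a pmf" and F :: "'a set set"
  assumes "finite F" "T > 0" "e \<ge> 0"
  shows "measure_pmf.prob (Pi_pmf {..<T} d (\<lambda>_. p))
           {x. \<exists>S\<in>F. \<bar>real (card {j\<in>{..<T}. x j \<in> S}) / real T - measure_pmf.prob p S\<bar> \<ge> e}
         \<le> card F * (2 * exp (- 2 * real T * e\<^sup>2))"
proof -
  let ?P = "Pi_pmf {..<T} d (\<lambda>_. p)"
  let ?B = "\<lambda>S. {x. \<bar>real (card {j\<in>{..<T}. x j \<in> S}) / real T - measure_pmf.prob p S\<bar> \<ge> e}"
  have B: "measure_pmf.prob ?P (?B S) \<le> 2 * exp (- 2 * real T * e\<^sup>2)" for S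
  proof -
    have "(\<Sum>j<T. indicator S (x j)) = real (card {j\<in>{..<T}. x j \<in> S})" for x
      by (simp add: indicator_def sum.If_cases Int_def)
    then show ?thesis
      using hoeffding_Pi_pmf[of "indicator S" T e d p] assms by (simp add: indicator_def)
  qed
  have "{x. \<exists>S\<in>F. \<bar>real (card {j\<in>{..<T}. x j \<in> S}) / real T - measure_pmf.prob p S\<bar> \<ge> e} = (\<Union>S\<in>F. ?B S)"
    by auto
  also have "measure_pmf.prob ?P \<dots> \<le> (\<Sum>S\<in>F. measure_pmf.prob ?P (?B S))"
    using assms by (intro measure_pmf.finite_measure_subadditive_finite) auto
  also have "\<dots> \<le> (\<Sum>S\<in>F. 2 * exp (- 2 * real T * e\<^sup>2))"
    by (intro sum_mono B)
  finally show ?thesis by simp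
qed

text \<open>Turns a bound with high probability into a bound on the mean: as \<open>f\<close> never
  exceeds 1, the exceptional event costs at most its probability.\<close>

lemma expectation_le_of_prob:
  fixes f :: "'a \<Rightarrow> real"
  assumes f: "\<And>x. f x \<in> {0..1}" and "u \<ge> 0" and "measure_pmf.prob p {x. f x > u} \<le> d"
  shows "measure_pmf.expectation p f \<le> u + d"
proof -
  have int: "integrable p f" "integrable p (indicator {x. f x > u} :: 'a \<Rightarrow> real)"
    by (rule measure_pmf.integrable_const_bound[where B = 1]; use f in \<open>auto simp: indicator_def\<close>)+
  have "measure_pmf.expectation p f \<le> measure_pmf.expectation p (\<lambda>x. u + indicator {x. f x > u} x)"
  proof (intro integral_mono int Bochner_Integration.integrable_add)
    show "f x \<le> u + indicator {x. f x > u} x" for x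
      using f[of x] \<open>u \<ge> 0\<close> by (auto simp: indicator_def)
  qed auto
  also have "\<dots> = u + measure_pmf.prob p {x. f x > u}"
    using int(2) by (subst Bochner_Integration.integral_add) auto
  finally show ?thesis using assms by simp
qed

lemma expectation_ge_of_prob:
  fixes f :: "'a \<Rightarrow> real"
  assumes f: "\<And>x. f x \<in> {0..1}" and "u \<le> 1" and "measure_pmf.prob p {x. f x < u} \<le> d"
  shows "measure_pmf.expectation p f \<ge> u - d"
proof -
  have "{x. 1 - f x > 1 - u} = {x. f x < u}" by auto
  then have "measure_pmf.expectation p (\<lambda>x. 1 - f x) \<le> 1 - u + d"
    using assms by (intro expectation_le_of_prob) auto
  moreover have "integrable p f"
    by (rule measure_pmf.integrable_const_bound[where B = 1]) (use f in auto)
  ultimately show ?thesis by simp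
qed

text \<open>Meant for two-stage sampling: the first draw selects staircases, the second evaluates
  them, and the second guarantee is only available after a good first draw.\<close>

lemma prob_bind_ge:
  assumes "measure_pmf.prob p G \<ge> a" and "\<And>x. x \<in> G \<Longrightarrow> measure_pmf.prob (f x) S \<ge> b" and "b \<ge> 0"
  shows "measure_pmf.prob (bind_pmf p f) S \<ge> a * b"
proof -
  have "ennreal (a * b) \<le> emeasure p G * ennreal b"
    using assms by (simp add: measure_pmf.emeasure_eq_measure ennreal_mult' [symmetric]
       ennreal_leI mult_right_mono flip: ennreal_mult)
  also have "\<dots> = (\<integral>\<^sup>+x. ennreal b * indicator G x \<partial>p)"
    by (simp add: nn_integral_cmult mult.commute)
  also have "\<dots> \<le> (\<integral>\<^sup>+x. emeasure (f x) S \<partial>p)"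
    by (intro nn_integral_mono)
      (use assms(2) in \<open>auto simp: indicator_def measure_pmf.emeasure_eq_measure ennreal_leI\<close>)
  also have "\<dots> = emeasure (bind_pmf p f) S"
    by simp
  finally show ?thesis
    by (simp add: measure_pmf.emeasure_eq_measure)
qed

section \<open>Greedy coverings\<close>

text \<open>New picks go to the front, so longer runs extend shorter ones. A run of fixed length
  thus contains the picks of all shorter runs.\<close>

primrec greedy :: "('a \<Rightarrow> 'b set) \<Rightarrow> ('a \<Rightarrow> bool) \<Rightarrow> nat \<Rightarrow> 'a list" where
  "greedy H P 0 = []"
| "greedy H P (Suc k) =
     arg_max (\<lambda>a. card (H a - \<Union>(H ` set (greedy H P k)))) P # greedy H P k"

lemma length_greedy: "length (greedy H P k) = k"
  by (induction k) auto

lemma greedy_mono: "k \<le> k' \<Longrightarrow> set (greedy H P k) \<subseteq> set (greedy H P k')"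
  by (induction k' rule: nat_induct) (auto simp: le_Suc_eq)

lemma arg_max_cover:
  assumes "finite S" "\<And>a. H a \<subseteq> S" "P a0"
  shows "P (arg_max (\<lambda>a. card (H a - U)) P)"
    and "P a \<Longrightarrow> card (H a - U) \<le> card (H (arg_max (\<lambda>a. card (H a - U)) P) - U)"
proof -
  \<comment> \<open>The candidates may form an infinite set, as threshold sequences do. The maximum
    exists because the objective is a natural number bounded by \<open>card S\<close>.\<close>
  have "card (H a - U) < Suc (card S)" for a
    using card_mono[of S "H a - U"] assms(1) assms(2)[of a] by (auto simp: less_Suc_eq_le)
  then have "P (arg_max (\<lambda>a. card (H a - U)) P) \<and>
    (\<forall>a. P a \<longrightarrow> card (H a - U) \<le> card (H (arg_max (\<lambda>a. card (H a - U)) P) - U))"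
    using assms(3) by (intro arg_max_nat_lemma) auto
  then show "P (arg_max (\<lambda>a. card (H a - U)) P)"
    "P a \<Longrightarrow> card (H a - U) \<le> card (H (arg_max (\<lambda>a. card (H a - U)) P) - U)" by auto
qed

lemma greedy_sound:
  assumes "finite S" "\<And>a. H a \<subseteq> S" "P a0" "a \<in> set (greedy H P k)"
  shows "P a"
  using assms(4)
proof (induction k)
  case (Suc k)
  then show ?case using arg_max_cover(1)[where S = S and H = H and P = P] assms(1-3) by auto
qed simp

text \<open>Each pick gains at least as many new points as \<open>a\<close> would have gained at
  that moment, hence at least the final residual of \<open>a\<close>. The gains are disjoint subsets
  of \<open>S\<close>.\<close>

lemma greedy_residual:
  assumes S: "finite S" "\<And>a. H a \<subseteq> S" and "P a"
  shows "k * card (H a - \<Union>(H ` set (greedy H P k))) \<le> card S"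
proof -
  have "k * card (H a - \<Union>(H ` set (greedy H P k))) \<le> card (\<Union>(H ` set (greedy H P k)))"
  proof (induction k)
    case (Suc k)
    define U where "U = \<Union>(H ` set (greedy H P k))"
    define b where "b = arg_max (\<lambda>a. card (H a - U)) P"
    have fin: "finite (H a)" "finite U" for a
      using finite_subset[OF S(2) S(1)] by (auto simp: U_def)
    have U': "\<Union>(H ` set (greedy H P (Suc k))) = U \<union> (H b - U)"
      by (auto simp: U_def b_def)
    have "card (H a - U) \<le> card (H b - U)"
      unfolding b_def by (rule arg_max_cover(2)[of S]) (use S \<open>P a\<close> in auto)
    moreover have "card (H a - (U \<union> (H b - U))) \<le> card (H a - U)"
      using fin by (intro card_mono) auto
    then have "Suc k * card (H a - (U \<union> (H b - U))) \<le> Suc k * card (H a - U)"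
      by (rule mult_le_mono2)
    moreover have "card (U \<union> (H b - U)) = card U + card (H b - U)"
      using fin by (intro card_Un_disjoint) auto
    ultimately show ?case
      using Suc.IH unfolding U' U_def[symmetric] by simp
  qed simp
  also have "\<dots> \<le> card S"
    using S by (intro card_mono) auto
  finally show ?thesis .
qed

section \<open>Staircases\<close>

definition lis :: "nat set \<Rightarrow> (nat \<Rightarrow> real) \<Rightarrow> nat" where
  "lis P A = Max {card L | L. L \<subseteq> P \<and> mono_on L A}"

lemma LIS_eq_lis: "LIS n A = lis {1..n} A"
  by (simp add: LIS_def lis_def)

lemma
  assumes "finite P"
  shows lis_ge: "L \<subseteq> P \<Longrightarrow> mono_on L A \<Longrightarrow> card L \<le> lis P A"
    and lis_obtain: "\<exists>L. L \<subseteq> P \<and> mono_on L A \<and> card L = lis P A"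
proof -
  let ?S = "{card L | L. L \<subseteq> P \<and> mono_on L A}"
  have "finite ?S"
    using assms by (auto intro!: finite_subset[of ?S "card ` Pow P"])
  moreover have "card {} \<in> ?S"
    by (intro CollectI exI[of _ "{}"]) auto
  then have "?S \<noteq> {}" by blast
  ultimately have "Max ?S \<in> ?S" and "\<And>a. a \<in> ?S \<Longrightarrow> a \<le> Max ?S"
    by (auto simp del: mem_Collect_eq)
  then show "L \<subseteq> P \<Longrightarrow> mono_on L A \<Longrightarrow> card L \<le> lis P A"
    and "\<exists>L. L \<subseteq> P \<and> mono_on L A \<and> card L = lis P A"
    unfolding lis_def by auto
qed

lemma lis_le_card: "finite P \<Longrightarrow> lis P A \<le> card P"
  using lis_obtain[of P A] card_mono by metis

lemma lis_mono: "finite Q \<Longrightarrow> P \<subseteq> Q \<Longrightarrow> lis P A \<le> lis Q A"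
  by (metis finite_subset lis_ge lis_obtain order_trans)

text \<open>Closed intervals let neighbouring cells share an endpoint value, as nondecreasing
  sequences may repeat values. The partition \<open>g\<close> is a parameter because the notion is
  used both for columns and for the finer cells inside them.\<close>

definition stair :: "(nat \<Rightarrow> nat) \<Rightarrow> (nat \<Rightarrow> real) \<Rightarrow> (nat \<Rightarrow> real) \<Rightarrow> nat set" where
  "stair g t A = {p. t (g p) \<le> A p \<and> A p \<le> t (Suc (g p))}"

lemma stair_separated:
  assumes "mono t" "p \<in> stair g t A" "q \<in> stair g t A" "g p < g q"
  shows "A p \<le> A q"
proof -
  have "t (Suc (g p)) \<le> t (g q)" using assms(1,4) by (auto simp: mono_def)
  then show ?thesis using assms(2,3) by (auto simp: stair_def)
qed

text \<open>Running maxima of the values of \<open>L\<close> serve as thresholds. Confining them to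
  \<open>{lo..hi}\<close> permits nesting: later these bounds are two consecutive thresholds of a
  coarser staircase.\<close>

lemma stair_covers:
  assumes "finite L" "mono_on L A" "mono g" "A ` L \<subseteq> {lo..hi}" "lo \<le> hi"
  obtains t where "mono t" "range t \<subseteq> {lo..hi}" "L \<subseteq> stair g t A"
proof
  \<comment> \<open>The largest value of \<open>L\<close> strictly before cell \<open>i\<close>;
    \<open>lo\<close> stands in when there is none.\<close>
  define t where "t i = Max (insert lo (A ` {p\<in>L. g p < i}))" for i
  have fin: "finite (insert lo (A ` {p\<in>L. g p < i}))" for i using assms by auto
  show "mono t"
    unfolding t_def mono_def using fin by (intro allI impI Max_mono) auto
  show "range t \<subseteq> {lo..hi}"
    using assms(4,5) fin unfolding t_def by (force simp: Max_ge_iff)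
  show "L \<subseteq> stair g t A"
  proof
    fix p assume p: "p \<in> L"
    have "A q \<le> A p" if "q \<in> L" "g q < g p" for q
    proof -
      have "q \<le> p" using that(2) monoD[OF \<open>mono g\<close>, of p q] by (cases "p \<le> q") auto
      then show ?thesis using assms(2) p that by (auto simp: mono_on_def)
    qed
    then have "t (g p) \<le> A p" using p assms(4) fin unfolding t_def by auto
    moreover have "A p \<le> t (Suc (g p))"
      unfolding t_def using p fin by (intro Max_ge) auto
    ultimately show "p \<in> stair g t A" by (simp add: stair_def)
  qed
qed

text \<open>Increasing sets chosen separately in the columns can be concatenated, because staircase
  points in different columns are already in order. A staircase therefore never overestimates the
  LIS.\<close>

lemma sum_lis_stair_le:
  assumes "finite P" "mono t" "mono g"
  shows "(\<Sum>i<m. lis (P \<inter> g -` {i} \<inter> stair g t A) A) \<le> lis P A"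
proof -
  have "\<exists>L. L \<subseteq> P \<inter> g -` {i} \<inter> stair g t A \<and> mono_on L A \<and> card L = lis (P \<inter> g -` {i} \<inter> stair g t A) A" for i
    using assms(1) by (intro lis_obtain) auto
  then obtain L where L: "\<And>i. L i \<subseteq> P \<inter> g -` {i} \<inter> stair g t A" "\<And>i. mono_on (L i) A"
    "\<And>i. card (L i) = lis (P \<inter> g -` {i} \<inter> stair g t A) A" by metis
  have "mono_on (\<Union>i<m. L i) A"
  proof (rule mono_onI)
    fix p q assume pq: "p \<in> (\<Union>i<m. L i)" "q \<in> (\<Union>i<m. L i)" "p \<le> q"
    then obtain i j where ij: "p \<in> L i" "q \<in> L j" by auto
    then have g: "g p = i" "g q = j" "p \<in> stair g t A" "q \<in> stair g t A" using L(1) by blast+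
    have "i \<le> j" using \<open>p \<le> q\<close> \<open>mono g\<close> g by (auto simp: mono_def)
    then show "A p \<le> A q"
      using L(2)[of i] ij pq(3) stair_separated[OF \<open>mono t\<close> g(3,4)] g
      by (cases "i = j") (auto simp: mono_on_def)
  qed
  then have "card (\<Union>i<m. L i) \<le> lis P A"
    using L(1) assms(1) by (intro lis_ge) auto
  also have "card (\<Union>i<m. L i) = (\<Sum>i<m. card (L i))"
  proof (rule card_UN_disjoint)
    show "\<forall>i\<in>{..<m}. finite (L i)" using L(1) assms(1) by (meson finite_Int finite_subset)
    show "\<forall>i\<in>{..<m}. \<forall>j\<in>{..<m}. i \<noteq> j \<longrightarrow> L i \<inter> L j = {}" using L(1) by blast
  qed auto
  finally show ?thesis using L(3) by simp
qed

text \<open>The part of \<open>L\<close> inside each column competes for the LIS there, so a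
  staircase that captures much of an increasing set has a large sum.\<close>

lemma card_le_sum_lis_stair:
  assumes "finite P" "L \<subseteq> P" "mono_on L A" "g ` P \<subseteq> {..<m}"
  shows "card (L \<inter> stair g t A) \<le> (\<Sum>i<m. lis (P \<inter> g -` {i} \<inter> stair g t A) A)"
proof -
  have "L \<inter> stair g t A = (\<Union>i<m. L \<inter> g -` {i} \<inter> stair g t A)"
    using assms(2,4) by auto
  also have "card \<dots> \<le> (\<Sum>i<m. card (L \<inter> g -` {i} \<inter> stair g t A))"
    by (intro card_UN_le) auto
  also have "\<dots> \<le> (\<Sum>i<m. lis (P \<inter> g -` {i} \<inter> stair g t A) A)"
    using assms by (intro sum_mono lis_ge) (auto intro: mono_on_subset)
  finally show ?thesis .
qed

text \<open>A value of one column can recur in a later column only if it is the maximum of the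
  earlier one. Dropping the maxima makes the value sets disjoint; truncated subtraction gives 0 for
  empty columns.\<close>

lemma sum_distinct_stair_le:
  assumes "finite P" "mono t"
  shows "(\<Sum>i<m. card (A ` (P \<inter> g -` {i} \<inter> stair g t A)) - 1) \<le> card (A ` P)"
proof -
  define V where "V i = A ` (P \<inter> g -` {i} \<inter> stair g t A)" for i
  have fin: "finite (V i)" for i using assms(1) by (auto simp: V_def)
  have sep: "v \<le> w" if "v \<in> V i" "w \<in> V j" "i < j" for v w i j
    using that stair_separated[OF \<open>mono t\<close>] by (fastforce simp: V_def)
  have disj: "(V i - {Max (V i)}) \<inter> V j = {}" if "i < j" for i j
  proof -
    have False if v: "v \<in> V i" "v \<noteq> Max (V i)" "v \<in> V j" for v
    proof -
      have "Max (V i) \<in> V i" using v fin by (intro Max_in) auto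
      then have "Max (V i) \<le> v" using sep v \<open>i < j\<close> by blast
      moreover have "v \<le> Max (V i)" using v fin by auto
      ultimately show False using v by simp
    qed
    then show ?thesis by auto
  qed
  have "card (V i) - 1 = card (V i - {Max (V i)})" for i
    using fin[of i] by (cases "V i = {}") (auto simp: card_Diff_singleton)
  then have "(\<Sum>i<m. card (V i) - 1) = (\<Sum>i<m. card (V i - {Max (V i)}))" by simp
  also have "\<dots> = card (\<Union>i<m. V i - {Max (V i)})"
  proof (rule card_UN_disjoint[symmetric])
    show "\<forall>i\<in>{..<m}. \<forall>j\<in>{..<m}. i \<noteq> j \<longrightarrow> (V i - {Max (V i)}) \<inter> (V j - {Max (V j)}) = {}"
    proof (intro ballI impI)
      fix i j :: nat assume "i \<noteq> j"
      then consider "i < j" | "j < i" by linarith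
      then show "(V i - {Max (V i)}) \<inter> (V j - {Max (V j)}) = {}"
        using disj[of i j] disj[of j i] by cases blast+
    qed
  qed (use fin in auto)
  also have "\<dots> \<le> card (A ` P)"
    using assms(1) by (intro card_mono) (auto simp: V_def)
  finally show ?thesis by (simp add: V_def)
qed

text \<open>In every fibre keep the points that share their value with the first one. A fibre that loses
  points carries two values, and since consecutive fibres share at most an endpoint, the largest
  values of these fibres are distinct.\<close>
lemma card_stair_le_lis:
  assumes "finite P" "mono t" "mono g" "\<And>i. card (P \<inter> g -` {i}) \<le> Suc c" "P \<subseteq> stair g t A"
  shows "card P \<le> lis P A + card (A ` P) * c"
proof -
  define F where "F i = P \<inter> g -` {i}" for i
  have fin: "finite (F i)" for i using assms(1) by (auto simp: F_def)
  define L where "L = {p\<in>P. A p = A (Min (F (g p)))}"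
  have "mono_on L A"
  proof (rule mono_onI)
    fix p q assume pq: "p \<in> L" "q \<in> L" "p \<le> q"
    then have "g p \<le> g q" using \<open>mono g\<close> by (auto simp: mono_def)
    then show "A p \<le> A q"
      using stair_separated[OF \<open>mono t\<close>, of p g A q] pq assms(5)
      by (cases "g p = g q") (auto simp: L_def)
  qed
  then have lisL: "card L \<le> lis P A"
    using assms(1) by (intro lis_ge) (auto simp: L_def)
  define B where "B = g ` (P - L)"
  have two: "\<exists>p q. p \<in> F i \<and> q \<in> F i \<and> A p < A q" if "i \<in> B" for i
  proof -
    obtain p where p: "p \<in> P" "A p \<noteq> A (Min (F (g p)))" "g p = i"
      using \<open>i \<in> B\<close> by (auto simp: B_def L_def)
    then have "p \<in> F i" "Min (F i) \<in> F i"
      using Min_in[OF fin, of i] by (auto simp: F_def)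
    with p show ?thesis by (metis linorder_neqE)
  qed
  have inj: "inj_on (\<lambda>i. Max (A ` F i)) B"
  proof (rule linorder_inj_onI)
    fix i j assume ij: "i < j" "i \<in> B" "j \<in> B"
    obtain p q where pq: "p \<in> F j" "q \<in> F j" "A p < A q" using two ij by blast
    have "F i \<noteq> {}" using two ij by blast
    then have "Max (A ` F i) \<in> A ` F i" using fin by (intro Max_in) auto
    then obtain x where x: "x \<in> F i" "Max (A ` F i) = A x" by auto
    have "A x \<le> A p"
      using x pq ij assms(5) by (intro stair_separated[OF \<open>mono t\<close>]) (auto simp: F_def)
    also have "\<dots> < A q" by fact
    also have "A q \<le> Max (A ` F j)" using pq fin by auto
    finally show "Max (A ` F i) \<noteq> Max (A ` F j)" using x by simp
  qed auto
  have "Max (A ` F i) \<in> A ` P" if "i \<in> B" for i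
  proof -
    have "F i \<noteq> {}" using two that by blast
    then have "Max (A ` F i) \<in> A ` F i" using fin by (intro Max_in) auto
    then show ?thesis by (auto simp: F_def)
  qed
  then have "card B \<le> card (A ` P)"
    using inj assms(1) by (intro card_inj_on_le) auto
  moreover have "card (P - L) \<le> card B * c"
  proof -
    have "P - L = (\<Union>i\<in>B. F i - L)" by (auto simp: B_def F_def)
    also have "card \<dots> \<le> (\<Sum>i\<in>B. card (F i - L))"
      using assms(1) by (intro card_UN_le) (auto simp: B_def)
    also have "\<dots> \<le> (\<Sum>i\<in>B. c)"
    proof (rule sum_mono)
      fix i assume "i \<in> B"
      then have "F i \<noteq> {}" using two by blast
      then have "Min (F i) \<in> F i" using fin by auto
      then have "Min (F i) \<in> F i \<inter> L" by (auto simp: F_def L_def)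
      then have "card (F i - L) \<le> card (F i - {Min (F i)})"
        using fin by (intro card_mono) auto
      also have "\<dots> = card (F i) - 1" using \<open>Min (F i) \<in> F i\<close> fin by simp
      also have "\<dots> \<le> c" using assms(4)[of i] by (simp add: F_def)
      finally show "card (F i - L) \<le> c" .
    qed
    finally show ?thesis by simp
  qed
  ultimately have "card (P - L) \<le> card (A ` P) * c" by (meson le_trans mult_le_mono1)
  moreover have "card P = card L + card (P - L)"
    using assms(1) by (subst card_Un_disjoint[symmetric]) (auto simp: L_def intro: arg_cong[of _ _ card])
  ultimately show ?thesis using lisL by simp
qed

text \<open>Only the set of array values between two thresholds matters in a cell. It is empty or
  determined by its smallest and largest element, which leaves at most \<open>r\<^sup>2 + 1\<close>
  choices per occupied cell.\<close>

lemma card_stair_family: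
  assumes "finite P" "card (g ` P) \<le> m" "card (A ` P) \<le> r"
  shows "finite (range (\<lambda>t. P \<inter> stair g t A))"
    and "card (range (\<lambda>t. P \<inter> stair g t A)) \<le> (r\<^sup>2 + 1) ^ m"
proof -
  define V where "V = A ` P"
  define I where "I = insert {} ((\<lambda>(a, b). V \<inter> {a..b}) ` (V \<times> V))"
  have "finite V" using assms(1) by (simp add: V_def)
  then have "finite I" by (simp add: I_def)
  have "card ((\<lambda>(a, b). V \<inter> {a..b}) ` (V \<times> V)) \<le> card V * card V"
    using \<open>finite V\<close> by (metis card_cartesian_product card_image_le finite_cartesian_product)
  also have "\<dots> \<le> r * r" using assms(3) by (intro mult_le_mono) (auto simp: V_def)
  finally have "card ((\<lambda>(a, b). V \<inter> {a..b}) ` (V \<times> V)) \<le> r\<^sup>2"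
    by (simp add: power2_eq_square)
  then have cI: "card I \<le> r\<^sup>2 + 1"
    using card_insert_le_m1[of "r\<^sup>2 + 1"] by (simp add: I_def)
  have int: "V \<inter> {a..b} \<in> I" for a b
  proof (cases "V \<inter> {a..b} = {}")
    case False
    let ?W = "V \<inter> {a..b}"
    have "finite ?W" using \<open>finite V\<close> by simp
    then have mm: "Min ?W \<in> ?W" "Max ?W \<in> ?W" using False Min_in Max_in by blast+
    have "?W = V \<inter> {Min ?W..Max ?W}"
      using mm Min_le[OF \<open>finite ?W\<close>] Max_ge[OF \<open>finite ?W\<close>] by force
    with mm show ?thesis unfolding I_def by (intro insertI2 image_eqI[of _ _ "(Min ?W, Max ?W)"]) auto
  qed (simp add: I_def)
  define h where "h W = {p\<in>P. A p \<in> W (g p)}" for W :: "nat \<Rightarrow> real set"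
  have sub: "range (\<lambda>t. P \<inter> stair g t A) \<subseteq> h ` (PiE (g ` P) (\<lambda>_. I))"
  proof safe
    fix t
    have "P \<inter> stair g t A = h (\<lambda>i\<in>g ` P. V \<inter> {t i..t (Suc i)})"
      by (auto simp: h_def stair_def V_def)
    moreover have "(\<lambda>i\<in>g ` P. V \<inter> {t i..t (Suc i)}) \<in> PiE (g ` P) (\<lambda>_. I)" using int by auto
    ultimately show "P \<inter> stair g t A \<in> h ` (PiE (g ` P) (\<lambda>_. I))" by blast
  qed
  have finE: "finite (PiE (g ` P) (\<lambda>_. I))" using \<open>finite I\<close> assms(1) by (intro finite_PiE) auto
  then show "finite (range (\<lambda>t. P \<inter> stair g t A))" using finite_subset[OF sub] by simp
  have "card (range (\<lambda>t. P \<inter> stair g t A)) \<le> card (PiE (g ` P) (\<lambda>_. I))"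
    using card_mono[OF finite_imageI[OF finE] sub] card_image_le[OF finE, of h] by linarith
  also have "\<dots> = card I ^ card (g ` P)" using assms(1) by (simp add: card_PiE)
  also have "\<dots> \<le> (r\<^sup>2 + 1) ^ card (g ` P)" using cI by (intro power_mono) auto
  also have "\<dots> \<le> (r\<^sup>2 + 1) ^ m" using assms(2) by (intro power_increasing) auto
  finally show "card (range (\<lambda>t. P \<inter> stair g t A)) \<le> (r\<^sup>2 + 1) ^ m" .
qed

section \<open>Sampling staircases\<close>

text \<open>Sample indices instead of points, so that a point drawn repeatedly counts with
  multiplicity.\<close>

definition hits :: "nat set \<Rightarrow> (nat \<Rightarrow> nat) \<Rightarrow> nat \<Rightarrow> (nat \<Rightarrow> nat) \<Rightarrow> (nat \<Rightarrow> real) \<Rightarrow> (nat \<Rightarrow> real) \<Rightarrow> nat set" where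
  "hits P g q x A t = {j\<in>{..<q}. x j \<in> P \<inter> stair g t A}"

text \<open>After \<open>k\<close> picks no staircase retains more than a \<open>1 / k\<close>
  fraction of the samples, and concentration transfers this to points. Applied to a staircase
  containing \<open>L\<close>, it bounds the uncovered part of \<open>L\<close>; by pigeonhole one
  of the at most \<open>k\<close> chosen staircases holds its share of the rest.\<close>

lemma greedy_covers:
  fixes P :: "nat set" and e :: real
  assumes P: "finite P" "P \<noteq> {}" and "mono g" "card (g ` P) \<le> m" "card (A ` P) \<le> r"
    and "q > 0" "k > 0" "e \<ge> 0"
  shows "measure_pmf.prob (Pi_pmf {..<q} d (\<lambda>_. pmf_of_set P))
      {x. \<forall>L. L \<subseteq> P \<and> mono_on L A \<longrightarrow>
         (\<exists>t\<in>set (greedy (hits P g q x A) mono k).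
            real k * card (L \<inter> stair g t A) \<ge> card L - card P / real k - e * card P)}
    \<ge> 1 - real ((r\<^sup>2 + 1) ^ (m * (k + 1))) * (2 * exp (- 2 * real q * e\<^sup>2))"
proof -
  let ?M = "Pi_pmf {..<q} d (\<lambda>_. pmf_of_set P)"
  define St where "St t = P \<inter> stair g t A" for t
  define Fam where "Fam = range St"
  define Xs where "Xs = {xs. set xs \<subseteq> Fam \<and> length xs = k}"
  \<comment> \<open>The picks depend on the sample, so concentration is needed for all differences
    of one staircase and \<open>k\<close> others. This produces the exponent
    \<open>m * (k + 1)\<close>.\<close>
  define F where "F = (\<lambda>(S, xs). S - \<Union>(set xs)) ` (Fam \<times> Xs)"
  have fam: "finite Fam" "card Fam \<le> (r\<^sup>2 + 1) ^ m"
    using card_stair_family[OF P(1) assms(4,5)] by (auto simp: Fam_def St_def)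
  have Xs: "finite Xs" "card Xs = card Fam ^ k"
    using fam(1) finite_lists_length_eq[of Fam k] card_lists_length_eq[of Fam k] by (auto simp: Xs_def)
  have "card F \<le> card (Fam \<times> Xs)" unfolding F_def using fam Xs by (intro card_image_le) auto
  also have "\<dots> = card Fam ^ (k + 1)" by (simp add: card_cartesian_product Xs)
  also have "\<dots> \<le> ((r\<^sup>2 + 1) ^ m) ^ (k + 1)" using fam by (intro power_mono) auto
  finally have cF: "card F \<le> (r\<^sup>2 + 1) ^ (m * (k + 1))" by (simp only: power_mult)
  have finF: "finite F" using fam Xs by (auto simp: F_def)
  define Bad where "Bad = {x. \<exists>S\<in>F. \<bar>real (card {j\<in>{..<q}. x j \<in> S}) / real q
     - measure_pmf.prob (pmf_of_set P) S\<bar> \<ge> e}"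
  have "measure_pmf.prob ?M Bad \<le> card F * (2 * exp (- 2 * real q * e\<^sup>2))"
    unfolding Bad_def by (rule uniform_convergence) (use finF assms in auto)
  also have "\<dots> \<le> real ((r\<^sup>2 + 1) ^ (m * (k + 1))) * (2 * exp (- 2 * real q * e\<^sup>2))"
    using cF by (intro mult_right_mono of_nat_mono) auto
  finally have bad: "measure_pmf.prob ?M Bad \<le> \<dots>" .
  have good: "\<exists>t\<in>set (greedy (hits P g q x A) mono k).
            real k * card (L \<inter> stair g t A) \<ge> card L - card P / real k - e * card P"
    if x: "x \<in> - Bad" and L: "L \<subseteq> P" "mono_on L A" for x L
  proof -
    let ?H = "hits P g q x A"
    define ts where "ts = greedy ?H mono k"
    have len: "length ts = k" by (simp add: ts_def length_greedy)
    have finL: "finite L" using L P finite_subset by blast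
    obtain t0 where t0: "mono t0" "L \<subseteq> stair g t0 A"
    proof (rule stair_covers[OF finL L(2) \<open>mono g\<close>])
      \<comment> \<open>Inserting 0 provides bounds for the thresholds even if \<open>L\<close> is
        empty.\<close>
      show "A ` L \<subseteq> {Min (insert 0 (A ` L))..Max (insert 0 (A ` L))}"
        using finL by auto
      show "Min (insert 0 (A ` L)) \<le> Max (insert 0 (A ` L))"
        using finL by (meson Max_ge Min_le finite_imageI finite_insert insertI1 order_trans)
    qed auto
    define D where "D = St t0 - \<Union>(set (map St ts))"
    have "D \<in> F" unfolding F_def
      by (rule image_eqI[where x = "(St t0, map St ts)"]) (auto simp: D_def Fam_def Xs_def len)
    then have "\<bar>real (card {j\<in>{..<q}. x j \<in> D}) / real q - measure_pmf.prob (pmf_of_set P) D\<bar> < e"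
      using x by (auto simp: Bad_def not_le)
    moreover have "measure_pmf.prob (pmf_of_set P) D = card D / card P"
      using P by (subst measure_pmf_of_set) (auto simp: D_def St_def Int_absorb1 intro!: arg_cong[of _ _ card])
    moreover have "{j\<in>{..<q}. x j \<in> D} = ?H t0 - \<Union>(?H ` set ts)"
      by (auto simp: D_def St_def hits_def)
    moreover have "k * card (?H t0 - \<Union>(?H ` set ts)) \<le> card {..<q}"
      unfolding ts_def by (rule greedy_residual) (use t0 in \<open>auto simp: hits_def\<close>)
    then have "real k * real (card (?H t0 - \<Union>(?H ` set ts))) \<le> real q"
      by (metis card_lessThan of_nat_le_iff of_nat_mult)
    then have "real (card (?H t0 - \<Union>(?H ` set ts))) / real q \<le> 1 / real k"
      using \<open>q > 0\<close> \<open>k > 0\<close> by (simp add: field_simps)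
    ultimately have "card D / card P \<le> 1 / real k + e" by simp
    then have D: "card D \<le> card P / real k + e * card P"
      using P by (simp add: field_simps card_gt_0_iff)
    have "L \<subseteq> D \<union> (\<Union>t\<in>set ts. L \<inter> stair g t A)"
      using L t0 by (auto simp: D_def St_def)
    then have "card L \<le> card (D \<union> (\<Union>t\<in>set ts. L \<inter> stair g t A))"
      using finL P by (intro card_mono) (auto simp: D_def St_def)
    also have "\<dots> \<le> card D + card (\<Union>t\<in>set ts. L \<inter> stair g t A)" by (rule card_Un_le)
    also have "\<dots> \<le> card D + (\<Sum>t\<in>set ts. card (L \<inter> stair g t A))"
      by (intro add_left_mono card_UN_le) auto
    finally have "card L \<le> card D + (\<Sum>t\<in>set ts. card (L \<inter> stair g t A))" .
    then have le: "card L - card P / real k - e * card P \<le> (\<Sum>t\<in>set ts. real (card (L \<inter> stair g t A)))"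
      using D by (simp add: of_nat_sum[symmetric] del: of_nat_sum)
    have ne: "set ts \<noteq> {}" using len \<open>k > 0\<close> by auto
    define M where "M = Max ((\<lambda>t. card (L \<inter> stair g t A)) ` set ts)"
    have "M \<in> (\<lambda>t. card (L \<inter> stair g t A)) ` set ts"
      unfolding M_def using ne by (intro Max_in) auto
    then obtain t where t: "t \<in> set ts" "M = card (L \<inter> stair g t A)" by auto
    have "(\<Sum>t\<in>set ts. real (card (L \<inter> stair g t A))) \<le> (\<Sum>t\<in>set ts. real M)"
      unfolding M_def by (intro sum_mono of_nat_mono Max_ge) auto
    also have "\<dots> \<le> real k * real M"
      using card_length[of ts] len by (simp add: mult_right_mono)
    finally show ?thesis using le t unfolding ts_def by (intro bexI[of _ t]) auto
  qed
  have "1 - measure_pmf.prob ?M Bad = measure_pmf.prob ?M (- Bad)"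
    by (simp add: measure_pmf.prob_compl[symmetric] Compl_eq_Diff_UNIV)
  also have "\<dots> \<le> measure_pmf.prob ?M {x. \<forall>L. L \<subseteq> P \<and> mono_on L A \<longrightarrow>
         (\<exists>t\<in>set (greedy (hits P g q x A) mono k).
            real k * card (L \<inter> stair g t A) \<ge> card L - card P / real k - e * card P)}"
    by (intro measure_pmf.finite_measure_mono) (use good in auto)
  finally show ?thesis using bad by linarith
qed

section \<open>Estimating the LIS inside one column and one value range\<close>

text \<open>The range \<open>{lo..hi}\<close> enters only the post-processing, so a single sample
  \<open>y\<close> of the column serves every coarse staircase. This is what makes nonadaptive
  queries possible.\<close>

definition block_est :: "nat \<Rightarrow> (nat \<Rightarrow> nat) \<Rightarrow> real \<Rightarrow> real \<Rightarrow> (nat \<Rightarrow> nat) \<Rightarrow> (nat \<Rightarrow> real) \<Rightarrow> real" where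
  "block_est s g lo hi y A =
     real (Max ((\<lambda>u. card {j\<in>{..<s}. y j \<in> stair g u A}) ` {u. mono u \<and> range u \<subseteq> {lo..hi}})) / real s"

lemma
  assumes "lo \<le> hi"
  shows block_est_ge: "mono u \<Longrightarrow> range u \<subseteq> {lo..hi} \<Longrightarrow>
      real (card {j\<in>{..<s}. y j \<in> stair g u A}) / real s \<le> block_est s g lo hi y A"
    and block_est_obtain: "\<exists>u. mono u \<and> range u \<subseteq> {lo..hi} \<and>
      block_est s g lo hi y A = real (card {j\<in>{..<s}. y j \<in> stair g u A}) / real s"
proof -
  let ?S = "(\<lambda>u. card {j\<in>{..<s}. y j \<in> stair g u A}) ` {u. mono u \<and> range u \<subseteq> {lo..hi}}"
  \<comment> \<open>There are infinitely many threshold sequences \<open>u\<close> but only finitely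
    many counts, so the maximum is attained.\<close>
  have "card {j\<in>{..<s}. y j \<in> stair g u A} \<le> s" for u
    using card_mono[of "{..<s}" "{j\<in>{..<s}. y j \<in> stair g u A}"] by auto
  then have fin: "finite ?S" by (intro finite_subset[of ?S "{..s}"]) auto
  have "(\<lambda>_. lo) \<in> {u. mono u \<and> range u \<subseteq> {lo..hi}}" using assms by (auto simp: mono_def)
  then have "?S \<noteq> {}" by blast
  with fin have "Max ?S \<in> ?S" by (rule Max_in)
  then show "\<exists>u. mono u \<and> range u \<subseteq> {lo..hi} \<and>
      block_est s g lo hi y A = real (card {j\<in>{..<s}. y j \<in> stair g u A}) / real s"
    unfolding block_est_def by (elim imageE) (simp, blast)
  show "mono u \<Longrightarrow> range u \<subseteq> {lo..hi} \<Longrightarrow>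
      real (card {j\<in>{..<s}. y j \<in> stair g u A}) / real s \<le> block_est s g lo hi y A"
    unfolding block_est_def using fin by (intro divide_right_mono of_nat_mono Max_ge) auto
qed

lemma block_est_bounds:
  assumes "lo \<le> hi"
  shows "block_est s g lo hi y A \<in> {0..1}"
proof -
  obtain u where u: "block_est s g lo hi y A = real (card {j\<in>{..<s}. y j \<in> stair g u A}) / real s"
    using block_est_obtain[OF assms] by blast
  have "card {j\<in>{..<s}. y j \<in> stair g u A} \<le> s"
    using card_mono[of "{..<s}" "{j\<in>{..<s}. y j \<in> stair g u A}"] by auto
  then show ?thesis unfolding u by (auto simp: divide_le_eq_1)
qed

text \<open>For the lower bound, an LIS of \<open>W\<close> fits into a fine staircase. For the
  upper bound, a fine staircase exceeds an increasing set by at most \<open>c\<close> points per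
  distinct value. Failure of concentration shifts the mean by at most \<open>dl\<close>.\<close>

lemma block_est_expectation:
  fixes B :: "nat set" and e :: real and d :: nat
  assumes B: "finite B" "B \<noteq> {}" and g: "mono g" "\<And>i. card (B \<inter> g -` {i}) \<le> Suc c" "card (g ` B) \<le> G"
    and "card (A ` B) \<le> r" and "lo \<le> hi" "s > 0" "e \<ge> 0"
    and dl: "real ((r\<^sup>2 + 1) ^ G) * (2 * exp (- 2 * real s * e\<^sup>2)) \<le> dl"
  defines "W \<equiv> {p\<in>B. lo \<le> A p \<and> A p \<le> hi}"
    and "E \<equiv> measure_pmf.expectation (Pi_pmf {..<s} d (\<lambda>_. pmf_of_set B)) (\<lambda>y. block_est s g lo hi y A)"
  shows "lis W A / card B - e - dl \<le> E"
    and "E \<le> (lis W A + card (A ` W) * c) / card B + e + dl"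
proof -
  let ?M = "Pi_pmf {..<s} d (\<lambda>_. pmf_of_set B)"
  define F where "F = range (\<lambda>u. B \<inter> stair g u A)"
  have F: "finite F" "card F \<le> (r\<^sup>2 + 1) ^ G"
    using card_stair_family[OF B(1) g(3) assms(6)] by (auto simp: F_def)
  define Bad where "Bad = {y. \<exists>S\<in>F. \<bar>real (card {j\<in>{..<s}. y j \<in> S}) / real s
     - measure_pmf.prob (pmf_of_set B) S\<bar> \<ge> e}"
  have "measure_pmf.prob ?M Bad \<le> card F * (2 * exp (- 2 * real s * e\<^sup>2))"
    unfolding Bad_def by (rule uniform_convergence) (use F assms in auto)
  also have "\<dots> \<le> real ((r\<^sup>2 + 1) ^ G) * (2 * exp (- 2 * real s * e\<^sup>2))"
    using F by (intro mult_right_mono of_nat_mono) auto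
  finally have bad: "measure_pmf.prob ?M Bad \<le> dl" using dl by linarith
  have supp: "y j \<in> B" if "y \<in> set_pmf ?M" "j < s" for y j
    using that B by (auto simp: set_Pi_pmf PiE_dflt_def)
  have close: "\<bar>real (card {j\<in>{..<s}. y j \<in> stair g u A}) / real s - card (B \<inter> stair g u A) / card B\<bar> < e"
    if "y \<in> set_pmf ?M - Bad" for y u
  proof -
    have "\<bar>real (card {j\<in>{..<s}. y j \<in> B \<inter> stair g u A}) / real s
        - measure_pmf.prob (pmf_of_set B) (B \<inter> stair g u A)\<bar> < e"
      using that by (auto simp: Bad_def F_def not_le)
    moreover have "measure_pmf.prob (pmf_of_set B) (B \<inter> stair g u A) = card (B \<inter> stair g u A) / card B"
      using B by (subst measure_pmf_of_set) auto
    moreover have "{j\<in>{..<s}. y j \<in> B \<inter> stair g u A} = {j\<in>{..<s}. y j \<in> stair g u A}"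
      using supp that by auto
    ultimately show ?thesis by simp
  qed
  have W: "finite W" "W \<subseteq> B" using B by (auto simp: W_def)
  have lower: "lis W A / card B - e \<le> block_est s g lo hi y A" if "y \<in> set_pmf ?M - Bad" for y
  proof -
    obtain L where L: "L \<subseteq> W" "mono_on L A" "card L = lis W A"
      using lis_obtain[OF W(1)] by blast
    have "A ` L \<subseteq> {lo..hi}" using L(1) by (auto simp: W_def)
    then obtain u where u: "mono u" "range u \<subseteq> {lo..hi}" "L \<subseteq> stair g u A"
      by (rule stair_covers[OF finite_subset[OF L(1) W(1)] L(2) g(1) _ \<open>lo \<le> hi\<close>])
    have "lis W A \<le> card (B \<inter> stair g u A)"
      unfolding L(3)[symmetric] using B L W u by (intro card_mono) auto
    then have "lis W A / card B \<le> card (B \<inter> stair g u A) / card B"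
      by (simp add: divide_right_mono)
    then show ?thesis
      using close[OF that, of u] block_est_ge[OF \<open>lo \<le> hi\<close> u(1,2), of s y g A] by linarith
  qed
  have upper: "block_est s g lo hi y A \<le> (lis W A + card (A ` W) * c) / card B + e"
    if "y \<in> set_pmf ?M - Bad" for y
  proof -
    obtain u where u: "mono u" "range u \<subseteq> {lo..hi}"
      "block_est s g lo hi y A = real (card {j\<in>{..<s}. y j \<in> stair g u A}) / real s"
      using block_est_obtain[OF \<open>lo \<le> hi\<close>] by blast
    let ?P = "B \<inter> stair g u A"
    have range: "lo \<le> u i" "u i \<le> hi" for i
      using u(2) by (simp_all add: image_subset_iff)
    have sub: "?P \<subseteq> W"
    proof
      fix p assume "p \<in> ?P"
      then have "p \<in> B" "u (g p) \<le> A p" "A p \<le> u (Suc (g p))" by (auto simp: stair_def)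
      then show "p \<in> W"
        using range(1)[of "g p"] range(2)[of "Suc (g p)"] by (simp add: W_def)
    qed
    have "card ?P \<le> lis ?P A + card (A ` ?P) * c"
    proof (rule card_stair_le_lis)
      show "card (?P \<inter> g -` {i}) \<le> Suc c" for i
        by (rule order_trans[OF card_mono g(2)[of i]]) (use B in auto)
    qed (use B u g in auto)
    also have "lis ?P A \<le> lis W A"
      using lis_mono[OF W(1) sub] .
    also have "card (A ` ?P) \<le> card (A ` W)" using W sub by (intro card_mono) auto
    finally have "card ?P / card B \<le> (lis W A + card (A ` W) * c) / card B"
      by (intro divide_right_mono of_nat_mono) auto
    then show ?thesis using close[OF that, of u] u(3) by linarith
  qed
  \<comment> \<open>An event that misses the good part of the support is, up to probability zero,
    contained in \<open>Bad\<close>.\<close>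
  have le: "measure_pmf.prob ?M Y \<le> dl" if "Y \<inter> (set_pmf ?M - Bad) = {}" for Y
  proof -
    have "measure_pmf.prob ?M Y = measure_pmf.prob ?M (Y \<inter> set_pmf ?M)" by (simp add: measure_Int_set_pmf)
    also have "\<dots> \<le> measure_pmf.prob ?M Bad"
      using that by (intro measure_pmf.finite_measure_mono) auto
    finally show ?thesis using bad by simp
  qed
  have "lis W A \<le> card B" using lis_le_card[OF W(1), of A] card_mono[OF B(1) W(2)] by simp
  then have "lis W A / card B \<le> 1" by (auto simp: divide_le_eq_1)
  then have le1: "lis W A / card B - e \<le> 1" using \<open>e \<ge> 0\<close> by linarith
  have "{y. block_est s g lo hi y A < lis W A / card B - e} \<inter> (set_pmf ?M - Bad) = {}"
    using lower linorder_not_less by blast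
  from expectation_ge_of_prob[OF block_est_bounds[OF \<open>lo \<le> hi\<close>] le1 le[OF this]]
  show "lis W A / card B - e - dl \<le> E"
    by (simp add: E_def)
  have "{y. block_est s g lo hi y A > (lis W A + card (A ` W) * c) / card B + e} \<inter> (set_pmf ?M - Bad) = {}"
    using upper linorder_not_less by blast
  from expectation_le_of_prob[OF block_est_bounds[OF \<open>lo \<le> hi\<close>] _ le[OF this]]
  show "E \<le> (lis W A + card (A ` W) * c) / card B + e + dl"
    using \<open>e \<ge> 0\<close> by (simp add: E_def)
qed

section \<open>Averaging over random columns\<close>

text \<open>Taking the column of a uniform point selects columns with probability proportional to
  their size. So \<open>card P\<close> times the mean of a column density is the sum of the column
  counts, even for columns of unequal size.\<close>

definition block_sample :: "nat set \<Rightarrow> (nat \<Rightarrow> nat) \<Rightarrow> nat \<Rightarrow> (nat \<times> (nat \<Rightarrow> nat)) pmf" where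
  "block_sample P g s = pmf_of_set P \<bind>
     (\<lambda>p. map_pmf (Pair (g p)) (Pi_pmf {..<s} 0 (\<lambda>_. pmf_of_set (P \<inter> g -` {g p}))))"

definition stair_est :: "nat \<Rightarrow> (nat \<Rightarrow> nat) \<Rightarrow> (nat \<Rightarrow> real) \<Rightarrow> (nat \<Rightarrow> real) \<Rightarrow> nat \<times> (nat \<Rightarrow> nat) \<Rightarrow> real" where
  "stair_est s g t A = (\<lambda>(i, y). block_est s g (t i) (t (Suc i)) y A)"

lemma stair_est_bounds: "mono t \<Longrightarrow> stair_est s g t A z \<in> {0..1}"
  unfolding stair_est_def by (cases z) (simp add: block_est_bounds[simplified] monoD)

lemma set_block_sample:
  assumes "finite P" "P \<noteq> {}" "z \<in> set_pmf (block_sample P g s)" "j < s"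
  shows "snd z j \<in> P"
proof -
  obtain p y where p: "p \<in> P" "z = (g p, y)"
    "y \<in> set_pmf (Pi_pmf {..<s} 0 (\<lambda>_. pmf_of_set (P \<inter> g -` {g p})))"
    using assms(1-3) by (auto simp: block_sample_def)
  have "finite (P \<inter> g -` {g p})" "P \<inter> g -` {g p} \<noteq> {}" using p(1) assms(1) by auto
  then have "y j \<in> P \<inter> g -` {g p}"
    using p(3) assms(4) by (auto simp: set_Pi_pmf PiE_dflt_def)
  then show ?thesis using p by simp
qed

text \<open>The error \<open>m * R * c\<close> comes from the fine cells with several values; \<open>b * r / R\<close> bounds the
  total length of the columns in which the staircase has more than \<open>R\<close> distinct values.\<close>
lemma block_sample_expectation:
  fixes P :: "nat set" and e dl E :: real and b c m r R Z :: nat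
  assumes P: "finite P" "P \<noteq> {}" and g: "mono g" "g ` P \<subseteq> {..<m}" "\<And>i. card (P \<inter> g -` {i}) \<le> b"
    and h: "mono h" "\<And>i. card (P \<inter> h -` {i}) \<le> Suc c" "\<And>i. card (h ` (P \<inter> g -` {i})) \<le> G"
    and r: "card (A ` P) \<le> r" and "R > 0" "mono t" "s > 0" "e \<ge> 0"
    and dl: "real ((r\<^sup>2 + 1) ^ G) * (2 * exp (- 2 * real s * e\<^sup>2)) \<le> dl"
  defines "E \<equiv> measure_pmf.expectation (block_sample P g s) (stair_est s h t A)"
    and "Z \<equiv> (\<Sum>i<m. lis (P \<inter> g -` {i} \<inter> stair g t A) A)"
  shows "real Z - (e + dl) * card P \<le> card P * E"
    and "card P * E \<le> Z + m * R * c + (e + dl) * card P + b * r / R"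
proof -
  define B where "B i = P \<inter> g -` {i}" for i
  define W where "W i = B i \<inter> stair g t A" for i
  define \<phi> where "\<phi> i = measure_pmf.expectation (Pi_pmf {..<s} 0 (\<lambda>_. pmf_of_set (B i)))
    (\<lambda>y. block_est s h (t i) (t (Suc i)) y A)" for i
  have finB: "finite (B i)" for i using P by (auto simp: B_def)
  have dl0: "dl \<ge> 0" by (rule order_trans[OF _ dl]) simp
  have tt: "t i \<le> t (Suc i)" for i using \<open>mono t\<close> by (simp add: monoD)
  have W_eq: "{p \<in> B i. t i \<le> A p \<and> A p \<le> t (Suc i)} = W i" for i
    by (auto simp: W_def B_def stair_def)
  have "E = (\<Sum>p\<in>P. measure_pmf.expectation (map_pmf (Pair (g p))
      (Pi_pmf {..<s} 0 (\<lambda>_. pmf_of_set (B (g p))))) (stair_est s h t A) /\<^sub>R real (card P))"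
    unfolding E_def block_sample_def B_def
  proof (rule pmf_expectation_bind_pmf_of_set[OF P(2,1)])
    fix p assume "p \<in> P"
    then have "P \<inter> g -` {g p} \<noteq> {}" "finite (P \<inter> g -` {g p})" using P by auto
    then show "finite (set_pmf (map_pmf (Pair (g p)) (Pi_pmf {..<s} 0 (\<lambda>_. pmf_of_set (P \<inter> g -` {g p})))))"
      by (auto simp: set_Pi_pmf intro!: finite_imageI finite_PiE_dflt)
  qed
  also have "\<dots> = (\<Sum>p\<in>P. \<phi> (g p)) / card P"
    by (simp add: \<phi>_def stair_est_def sum_distrib_left divide_inverse mult.commute)
  finally have "card P * E = (\<Sum>p\<in>P. \<phi> (g p))" using P by simp
  also have "\<dots> = (\<Sum>i<m. \<Sum>p\<in>{p\<in>P. g p = i}. \<phi> (g p))"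
    using P g(2) by (intro sum.group[symmetric]) auto
  also have "\<dots> = (\<Sum>i<m. card (B i) * \<phi> i)"
  proof (rule sum.cong[OF refl])
    fix i
    have "{p\<in>P. g p = i} = B i" by (auto simp: B_def)
    then show "(\<Sum>p\<in>{p\<in>P. g p = i}. \<phi> (g p)) = card (B i) * \<phi> i" by (simp add: B_def)
  qed
  finally have E: "card P * E = (\<Sum>i<m. card (B i) * \<phi> i)" .
  have cards: "(\<Sum>i<m. real (card (B i))) = card P"
  proof -
    have "(\<Sum>i<m. \<Sum>p\<in>{p\<in>P. g p = i}. 1) = (\<Sum>p\<in>P. 1::real)"
      using P g(2) by (intro sum.group) auto
    moreover have "{p\<in>P. g p = i} = B i" for i by (auto simp: B_def)
    ultimately show ?thesis by simp
  qed
  have *: "lis (W i) A / card (B i) - e - dl \<le> \<phi> i"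
    "\<phi> i \<le> (lis (W i) A + card (A ` W i) * c) / card (B i) + e + dl" if "B i \<noteq> {}" for i
  proof -
    have 1: "card (B i \<inter> h -` {k}) \<le> Suc c" for k
      by (rule order_trans[OF card_mono h(2)[of k]]) (use P in \<open>auto simp: B_def\<close>)
    have 2: "card (h ` B i) \<le> G" using h(3) by (simp add: B_def)
    have 3: "card (A ` B i) \<le> r"
      by (rule order_trans[OF card_mono r]) (use P in \<open>auto simp: B_def\<close>)
    show "lis (W i) A / card (B i) - e - dl \<le> \<phi> i"
      "\<phi> i \<le> (lis (W i) A + card (A ` W i) * c) / card (B i) + e + dl"
      using block_est_expectation[OF finB that h(1) 1 2 3 tt[of i] \<open>s > 0\<close> \<open>e \<ge> 0\<close> dl, where d = 0]
      by (simp_all only: W_eq \<phi>_def)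
  qed
  have lower: "lis (W i) A - (e + dl) * card (B i) \<le> card (B i) * \<phi> i" for i
  proof (cases "B i = {}")
    case True
    then show ?thesis using lis_le_card[of "W i" A] by (simp add: W_def)
  next
    case False
    then have "card (B i) > 0" using finB by (simp add: card_gt_0_iff)
    then show ?thesis using *(1)[OF False] by (simp add: field_simps)
  qed
  have "(\<Sum>i<m. lis (W i) A - (e + dl) * card (B i)) \<le> card P * E"
    unfolding E by (intro sum_mono lower)
  then show "real Z - (e + dl) * card P \<le> card P * E"
    by (simp add: sum_subtractf sum_distrib_left[symmetric] cards[unfolded B_def] Z_def W_def B_def)
  define Bad where "Bad = {i\<in>{..<m}. card (A ` W i) > R}"
  have upper: "card (B i) * \<phi> i \<le> lis (W i) A + real (R * c) + (e + dl) * card (B i) + (if i \<in> Bad then real b else 0)"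
    if "i < m" for i
  proof (cases "B i = {}")
    case False
    then have pos: "card (B i) > 0" using finB by (simp add: card_gt_0_iff)
    show ?thesis
    proof (cases "i \<in> Bad")
      case True
      \<comment> \<open>In a column with more than \<open>R\<close> distinct values the trivial
        bound 1 on the density is all that is used.\<close>
      have "\<phi> i \<le> 1 + 0" unfolding \<phi>_def
        by (rule expectation_le_of_prob[OF block_est_bounds[OF tt]])
          (use block_est_bounds[OF tt] in \<open>auto simp: not_less[symmetric]\<close>)
      then have "card (B i) * \<phi> i \<le> real (card (B i)) * 1" by (intro mult_left_mono) auto
      also have "\<dots> \<le> real b" using g(3)[of i] by (simp add: B_def)
      finally show ?thesis using True dl0 \<open>e \<ge> 0\<close> by (simp add: add_increasing)
    next
      case good: False
      have "card (B i) * \<phi> i \<le> lis (W i) A + card (A ` W i) * c + (e + dl) * card (B i)"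
        using *(2)[OF False] pos by (simp add: field_simps)
      moreover have "card (A ` W i) * c \<le> R * c"
        using good that by (simp add: Bad_def)
      then have "real (card (A ` W i) * c) \<le> real (R * c)" by (rule of_nat_mono)
      ultimately show ?thesis using good by simp
    qed
  qed simp
  have "R * card Bad = (\<Sum>i\<in>Bad. R)" by simp
  \<comment> \<open>The strict inequality in \<open>Bad\<close> matters: at least \<open>R\<close>
    values remain after one value per column is given up to the overlaps.\<close>
  also have "\<dots> \<le> (\<Sum>i\<in>Bad. card (A ` W i) - 1)" by (intro sum_mono) (auto simp: Bad_def)
  also have "\<dots> \<le> (\<Sum>i<m. card (A ` W i) - 1)" by (intro sum_mono2) (auto simp: Bad_def)
  also have "\<dots> \<le> card (A ` P)"
    unfolding W_def B_def by (rule sum_distinct_stair_le[OF P(1) \<open>mono t\<close>])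
  finally have "R * card Bad \<le> r" using r by simp
  then have "real R * real (card Bad) \<le> real r" by (metis of_nat_le_iff of_nat_mult)
  then have "real b * real (card Bad) \<le> b * (r / R)"
    using \<open>R > 0\<close> by (intro mult_left_mono) (auto simp: field_simps)
  moreover have "(\<Sum>i<m. if i \<in> Bad then real b else 0) = real b * card Bad"
    by (simp add: sum.If_cases Bad_def Int_def)
  moreover have "card P * E \<le>
     (\<Sum>i<m. lis (W i) A + real (R * c) + (e + dl) * card (B i) + (if i \<in> Bad then real b else 0))"
    unfolding E by (intro sum_mono upper) auto
  ultimately show "card P * E \<le> Z + m * R * c + (e + dl) * card P + b * r / R"
    by (simp add: sum.distrib sum_distrib_left[symmetric] cards[unfolded B_def] Z_def W_def B_def mult.assoc)
qed

section \<open>The combined estimator\<close>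

definition estimate :: "nat set \<Rightarrow> (nat \<Rightarrow> nat) \<Rightarrow> (nat \<Rightarrow> nat) \<Rightarrow> nat \<Rightarrow> nat \<Rightarrow> nat \<Rightarrow> nat \<Rightarrow>
    (nat \<Rightarrow> nat) \<Rightarrow> (nat \<Rightarrow> nat \<times> (nat \<Rightarrow> nat)) \<Rightarrow> (nat \<Rightarrow> real) \<Rightarrow> real" where
  "estimate P g h q K T s x z A = card P *
     Max ((\<lambda>t. (\<Sum>j<T. stair_est s h t A (z j)) / T) ` set (greedy (hits P g q x A) mono K))"

text \<open>The array is inspected at sampled positions only, so the estimate can be computed from
  an array that is known only there.\<close>

lemma estimate_cong:
  assumes "\<And>j. j < q \<Longrightarrow> A (x j) = B (x j)" "\<And>j k. j < T \<Longrightarrow> k < s \<Longrightarrow> A (snd (z j) k) = B (snd (z j) k)"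
  shows "estimate P g h q K T s x z A = estimate P g h q K T s x z B"
proof -
  have "hits P g q x A = hits P g q x B"
    using assms(1) by (auto simp: hits_def stair_def fun_eq_iff)
  moreover have "stair_est s h t A (z j) = stair_est s h t B (z j)" if "j < T" for t j
  proof -
    have "{k\<in>{..<s}. snd (z j) k \<in> stair h u A} = {k\<in>{..<s}. snd (z j) k \<in> stair h u B}" for u
      using assms(2)[OF that] by (auto simp: stair_def)
    then show ?thesis by (simp add: stair_est_def block_est_def split_beta)
  qed
  then have "(\<Sum>j<T. stair_est s h t A (z j)) = (\<Sum>j<T. stair_est s h t B (z j))" for t by simp
  ultimately show ?thesis by (simp add: estimate_def)
qed

text \<open>Only the first \<open>k\<close> greedy staircases matter for the lower bound; running the greedy
  algorithm longer does no harm because every staircase yields a lower bound for the LIS. This is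
  why the guarantee can depend on the true ratio, although the algorithm does not know \<open>k\<close>.\<close>
lemma estimate_correct:
  fixes P :: "nat set" and e d1 d2 :: real and b c m r R :: nat
  assumes P: "finite P" "P \<noteq> {}" and g: "mono g" "g ` P \<subseteq> {..<m}" "\<And>i. card (P \<inter> g -` {i}) \<le> b"
    and h: "mono h" "\<And>i. card (P \<inter> h -` {i}) \<le> Suc c" "\<And>i. card (h ` (P \<inter> g -` {i})) \<le> G"
    and r: "card (A ` P) \<le> r" and pos: "R > 0" "s > 0" "q > 0" "T > 0" "k > 0" "e \<ge> 0" and "k \<le> K"
    and dq: "real ((r\<^sup>2 + 1) ^ (m * (K + 1))) * (2 * exp (- 2 * real q * e\<^sup>2)) \<le> d1"
    and ds: "real ((r\<^sup>2 + 1) ^ G) * (2 * exp (- 2 * real s * e\<^sup>2)) \<le> e"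
    and dT: "real K * (2 * exp (- 2 * real T * e\<^sup>2)) \<le> d2"
    and d: "d1 \<le> 1" "d2 \<le> 1"
    and err: "m * R * c + b * r / R \<le> 3 * e * card P"
  shows "measure_pmf.prob
     (Pi_pmf {..<q} 0 (\<lambda>_. pmf_of_set P) \<bind> (\<lambda>x. map_pmf (Pair x) (Pi_pmf {..<T} z0 (\<lambda>_. block_sample P g s))))
     {(x, z). (lis P A - card P / real k - e * card P) / k - 6 * e * card P \<le> estimate P g h q K T s x z A
        \<and> estimate P g h q K T s x z A \<le> lis P A + 6 * e * card P} \<ge> (1 - d1) * (1 - d2)"
    (is "measure_pmf.prob _ ?S \<ge> _")
proof (rule prob_bind_ge)
  let ?lo = "(lis P A - card P / real k - e * card P) / k - 6 * e * card P"
  let ?good = "{x. \<forall>L. L \<subseteq> P \<and> mono_on L A \<longrightarrow>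
         (\<exists>t\<in>set (greedy (hits P g q x A) mono k).
            real k * card (L \<inter> stair g t A) \<ge> card L - card P / real k - e * card P)}"
  have cg: "card (g ` P) \<le> m" using card_mono[OF _ g(2)] by simp
  have "real ((r\<^sup>2 + 1) ^ (m * (k + 1))) * (2 * exp (- 2 * real q * e\<^sup>2))
      \<le> real ((r\<^sup>2 + 1) ^ (m * (K + 1))) * (2 * exp (- 2 * real q * e\<^sup>2))"
    using \<open>k \<le> K\<close> by (intro mult_right_mono of_nat_mono power_increasing mult_le_mono2) auto
  then show "1 - d1 \<le> measure_pmf.prob (Pi_pmf {..<q} 0 (\<lambda>_. pmf_of_set P)) ?good"
    using greedy_covers[OF P g(1) cg r pos(3,5,6), of 0] dq by linarith
  show "0 \<le> 1 - d2" using d by simp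
  fix x assume x: "x \<in> ?good"
  define ts where "ts = greedy (hits P g q x A) mono K"
  define av where "av z t = (\<Sum>j<T. stair_est s h t A (z j)) / T" for z t
  define E where "E t = measure_pmf.expectation (block_sample P g s) (stair_est s h t A)" for t
  define Z where "Z t = (\<Sum>i<m. lis (P \<inter> g -` {i} \<inter> stair g t A) A)" for t
  let ?M = "Pi_pmf {..<T} z0 (\<lambda>_. block_sample P g s)"
  have mono: "mono t" if "t \<in> set ts" for t
    using greedy_sound[of "{..<q}" "hits P g q x A" mono "\<lambda>_. 0" t K] that
    by (auto simp: hits_def ts_def mono_def)
  \<comment> \<open>Of the five error units, one is \<open>e\<close> itself, one bounds the failure
    term supplied by \<open>ds\<close>, and three come from \<open>err\<close>. Averaging over
    \<open>T\<close> columns adds the sixth below.\<close>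
  have E: "real (Z t) - 5 * e * card P \<le> card P * E t" "card P * E t \<le> Z t + 5 * e * card P" if "t \<in> set ts" for t
    using block_sample_expectation[OF P g h r pos(1) mono[OF that] pos(2,6) ds] err \<open>e \<ge> 0\<close>
    unfolding E_def Z_def by (simp_all add: algebra_simps)
  \<comment> \<open>Once \<open>x\<close> is fixed, so is \<open>ts\<close>; a union bound over at
    most \<open>K\<close> staircases therefore suffices here.\<close>
  have "measure_pmf.prob ?M (\<Union>t\<in>set ts. {z. \<bar>av z t - E t\<bar> \<ge> e})
      \<le> (\<Sum>t\<in>set ts. measure_pmf.prob ?M {z. \<bar>av z t - E t\<bar> \<ge> e})"
    by (intro measure_pmf.finite_measure_subadditive_finite) auto
  also have "\<dots> \<le> (\<Sum>t\<in>set ts. 2 * exp (- 2 * real T * e\<^sup>2))"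
    unfolding av_def E_def using pos by (intro sum_mono hoeffding_Pi_pmf stair_est_bounds mono) auto
  also have "\<dots> \<le> real K * (2 * exp (- 2 * real T * e\<^sup>2))"
    using card_length[of ts] by (auto simp: ts_def length_greedy intro!: mult_right_mono)
  finally have bad: "measure_pmf.prob ?M (\<Union>t\<in>set ts. {z. \<bar>av z t - E t\<bar> \<ge> e}) \<le> d2"
    using dT by linarith
  have est: "estimate P g h q K T s x z A = card P * Max (av z ` set ts)" for z
    by (simp add: estimate_def ts_def av_def[abs_def])
  obtain L where L: "L \<subseteq> P" "mono_on L A" "card L = lis P A" using lis_obtain[OF P(1)] by blast
  have "\<exists>t\<in>set (greedy (hits P g q x A) mono k).
      real k * card (L \<inter> stair g t A) \<ge> card L - card P / real k - e * card P"
    using x L(1,2) by blast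
  then obtain t0 where t0: "t0 \<in> set (greedy (hits P g q x A) mono k)"
    "real k * card (L \<inter> stair g t0 A) \<ge> lis P A - card P / real k - e * card P"
    unfolding L(3) by blast
  have t0': "t0 \<in> set ts" using subsetD[OF greedy_mono[OF \<open>k \<le> K\<close>] t0(1)] by (simp add: ts_def)
  have "card (L \<inter> stair g t0 A) \<le> Z t0"
    unfolding Z_def by (rule card_le_sum_lis_stair[OF P(1) L(1,2) g(2)])
  then have "real k * card (L \<inter> stair g t0 A) \<le> real k * Z t0"
    by (intro mult_left_mono of_nat_mono) auto
  then have Z0: "(lis P A - card P / real k - e * card P) / k \<le> Z t0"
    using order_trans[OF t0(2)] \<open>k > 0\<close> by (simp add: pos_divide_le_eq mult.commute)
  have Zle: "Z t \<le> lis P A" if "t \<in> set ts" for t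
    unfolding Z_def by (rule sum_lis_stair_le[OF P(1) mono[OF that] g(1)])
  have good: "(x, z) \<in> ?S" if z: "z \<notin> (\<Union>t\<in>set ts. {z. \<bar>av z t - E t\<bar> \<ge> e})" for z
  proof -
    have av: "\<bar>card P * av z t - card P * E t\<bar> \<le> card P * e" if "t \<in> set ts" for t
    proof -
      have "\<bar>av z t - E t\<bar> \<le> e" using z that by (auto simp: not_le)
      then have "card P * \<bar>av z t - E t\<bar> \<le> card P * e" by (rule mult_left_mono) simp
      moreover have "\<bar>card P * av z t - card P * E t\<bar> = card P * \<bar>av z t - E t\<bar>"
        by (simp only: right_diff_distrib[symmetric] abs_mult abs_of_nat)
      ultimately show ?thesis by simp
    qed
    have "Max (av z ` set ts) \<in> av z ` set ts" using t0' by (intro Max_in) auto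
    then obtain t where t: "t \<in> set ts" "Max (av z ` set ts) = av z t" by auto
    have "card P * av z t \<le> lis P A + 6 * e * card P"
      using av[OF t(1)] E(2)[OF t(1)] Zle[OF t(1)] by (simp add: algebra_simps)
    moreover have "?lo \<le> card P * av z t0"
      using av[OF t0'] E(1)[OF t0'] Z0 by (simp add: algebra_simps)
    moreover have "av z t0 \<le> av z t" unfolding t(2)[symmetric] using t0' by (intro Max_ge) auto
    then have "card P * av z t0 \<le> card P * av z t" by (rule mult_left_mono) simp
    ultimately show ?thesis by (simp add: est t(2))
  qed
  have "1 - d2 \<le> measure_pmf.prob ?M (- (\<Union>t\<in>set ts. {z. \<bar>av z t - E t\<bar> \<ge> e}))"
    using bad measure_pmf.prob_compl[of "\<Union>t\<in>set ts. {z. \<bar>av z t - E t\<bar> \<ge> e}" ?M]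
    by (simp add: Compl_eq_Diff_UNIV)
  also have "\<dots> \<le> measure_pmf.prob ?M (Pair x -` ?S)"
    using good by (intro measure_pmf.finite_measure_mono) auto
  finally show "1 - d2 \<le> measure_pmf.prob (map_pmf (Pair x) ?M) ?S" by simp
qed

section \<open>The nonadaptive algorithm\<close>

text \<open>The answers are turned back into an array by \<open>map_of\<close>. Repeated queries are
  consistent because they return the same entry, and \<open>estimate_cong\<close> takes care of the
  unspecified values elsewhere.\<close>

definition lis_det :: "nat set \<Rightarrow> (nat \<Rightarrow> nat) \<Rightarrow> (nat \<Rightarrow> nat) \<Rightarrow> nat \<Rightarrow> nat \<Rightarrow> nat \<Rightarrow> nat \<Rightarrow>
    (nat \<Rightarrow> nat) \<Rightarrow> (nat \<Rightarrow> nat \<times> (nat \<Rightarrow> nat)) \<Rightarrow> det_alg" where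
  "lis_det P g h q K T s x z =
     (let qs = map x [0..<q] @ concat (map (\<lambda>j. map (snd (z j)) [0..<s]) [0..<T])
      in Det_Alg qs (\<lambda>ys. estimate P g h q K T s x z (\<lambda>p. the (map_of (zip qs ys) p))))"

lemma length_queries_lis_det: "length (queries (lis_det P g h q K T s x z)) = q + T * s"
  by (simp add: lis_det_def Let_def length_concat comp_def sum_list_triv)

lemma set_queries_lis_det:
  "set (queries (lis_det P g h q K T s x z)) = x ` {..<q} \<union> (\<Union>j<T. snd (z j) ` {..<s})"
  by (simp add: lis_det_def Let_def atLeast0LessThan)

lemma run_lis_det: "run (lis_det P g h q K T s x z) A = estimate P g h q K T s x z A"
proof -
  let ?qs = "queries (lis_det P g h q K T s x z)"
  have "run (lis_det P g h q K T s x z) A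
      = estimate P g h q K T s x z (\<lambda>p. the (map_of (zip ?qs (map A ?qs)) p))"
    by (simp add: run_def lis_det_def Let_def)
  also have "\<dots> = estimate P g h q K T s x z A"
    by (rule estimate_cong) (auto simp: map_of_zip_map set_queries_lis_det)
  finally show ?thesis .
qed

definition lis_alg :: "nat set \<Rightarrow> (nat \<Rightarrow> nat) \<Rightarrow> (nat \<Rightarrow> nat) \<Rightarrow> nat \<Rightarrow> nat \<Rightarrow> nat \<Rightarrow> nat \<Rightarrow> nonadaptive_alg" where
  "lis_alg P g h q K T s = map_pmf (\<lambda>(x, z). lis_det P g h q K T s x z)
     (Pi_pmf {..<q} 0 (\<lambda>_. pmf_of_set P) \<bind>
       (\<lambda>x. map_pmf (Pair x) (Pi_pmf {..<T} (0, \<lambda>_. 0) (\<lambda>_. block_sample P g s))))"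

lemma lis_alg_queries:
  assumes "finite P" "P \<noteq> {}" "D \<in> set_pmf (lis_alg P g h q K T s)"
  shows "set (queries D) \<subseteq> P" "length (queries D) = q + T * s"
proof -
  obtain x z where D: "D = lis_det P g h q K T s x z"
    and x: "x \<in> set_pmf (Pi_pmf {..<q} 0 (\<lambda>_. pmf_of_set P))"
    and z: "z \<in> set_pmf (Pi_pmf {..<T} (0, \<lambda>_. 0) (\<lambda>_. block_sample P g s))"
    using assms(3) by (auto simp: lis_alg_def)
  have "x j \<in> P" if "j < q" for j
    using x that assms(1,2) by (auto simp: set_Pi_pmf PiE_dflt_def)
  moreover have "snd (z j) k \<in> P" if "j < T" "k < s" for j k
    using z that set_block_sample[OF assms(1,2), of "z j" g s k] by (auto simp: set_Pi_pmf PiE_dflt_def)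
  ultimately show "set (queries D) \<subseteq> P"
    by (auto simp: D set_queries_lis_det)
  show "length (queries D) = q + T * s"
    by (simp add: D length_queries_lis_det)
qed

section \<open>Sizes of columns and fine cells\<close>

lemma vimage_div_subset: "b > 0 \<Longrightarrow> (\<lambda>p::nat. p div b) -` {i} \<subseteq> {i * b..<i * b + b}"
  using dividend_less_div_times[of b] by (auto simp: add.commute)

lemma card_vimage_div: "b > 0 \<Longrightarrow> card (P \<inter> (\<lambda>p::nat. p div b) -` {i}) \<le> b"
  using card_mono[of "{i * b..<i * b + b}" "P \<inter> (\<lambda>p. p div b) -` {i}"] vimage_div_subset[of b i]
  by auto

text \<open>A column contains at most \<open>b div c\<close> full cells and meets at most one
  partial cell at either end.\<close>

lemma card_image_div:
  fixes b c :: nat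
  assumes "b > 0"
  shows "card ((\<lambda>p. p div c) ` (P \<inter> (\<lambda>p. p div b) -` {i})) \<le> b div c + 2"
proof -
  have "(\<lambda>p. p div c) ` (P \<inter> (\<lambda>p. p div b) -` {i}) \<subseteq> {(i * b) div c..(i * b) div c + b div c + 1}"
  proof (intro image_subsetI)
    fix p assume "p \<in> P \<inter> (\<lambda>p. p div b) -` {i}"
    then have p: "i * b \<le> p" "p \<le> i * b + b"
      using vimage_div_subset[OF assms, of i] by auto
    have "p div c \<le> (i * b + b) div c" using p by (intro div_le_mono)
    also have "\<dots> = (i * b) div c + b div c + ((i * b) mod c + b mod c) div c"
      by (rule div_add1_eq)
    also have "((i * b) mod c + b mod c) div c \<le> 1"
    proof (cases "c = 0")
      case False
      then have "(i * b) mod c + b mod c < 2 * c"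
        using mod_less_divisor[of c "i * b"] mod_less_divisor[of c b] by linarith
      then have "((i * b) mod c + b mod c) div c < 2" using False by (simp add: div_less_iff_less_mult)
      then show ?thesis by simp
    qed simp
    finally show "p div c \<in> {(i * b) div c..(i * b) div c + b div c + 1}"
      using div_le_mono[OF p(1), of c] by simp
  qed
  from card_mono[OF _ this] show ?thesis by simp
qed

section \<open>Sample sizes and the error budget\<close>

lemma power_exp_le:
  fixes r M l :: nat
  assumes "ln ((real r)\<^sup>2 + 1) \<le> l"
  shows "real ((r\<^sup>2 + 1) ^ M) \<le> exp (real l * M)"
proof -
  have "real (r\<^sup>2 + 1) = exp (ln ((real r)\<^sup>2 + 1))" by (simp add: add_nonneg_pos)
  also have "\<dots> \<le> exp (real l)" using assms by simp
  finally have "real (r\<^sup>2 + 1) ^ M \<le> exp (real l) ^ M" by (intro power_mono) auto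
  then show ?thesis by (simp add: exp_of_nat_mult[symmetric] mult.commute)
qed

text \<open>A sample size of the form \<open>D\<^sup>2 * t\<close> cancels the squared accuracy
  \<open>1 / D\<close>, leaving the exponent \<open>2 * t\<close>. Of it, \<open>l * M\<close> pays
  for the size of the family and \<open>a\<close> remains as decay.\<close>

lemma union_bound_le:
  fixes r M l t D :: nat and a :: real
  assumes "ln ((real r)\<^sup>2 + 1) \<le> l" "D > 0" "real l * real M + a \<le> 2 * real t"
  shows "real ((r\<^sup>2 + 1) ^ M) * (2 * exp (- 2 * real (D\<^sup>2 * t) * (1 / real D)\<^sup>2)) \<le> 2 * exp (- a)"
proof -
  have t: "- 2 * real (D\<^sup>2 * t) * (1 / real D)\<^sup>2 = - 2 * real t"
    using assms(2) by (simp add: power_divide)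
  have "real ((r\<^sup>2 + 1) ^ M) * (2 * exp (- 2 * real t)) \<le> exp (real l * M) * (2 * exp (- 2 * real t))"
    using power_exp_le[OF assms(1), of M] by (rule mult_right_mono) simp
  also have "\<dots> = 2 * exp (real l * M - 2 * t)"
    by (simp add: exp_diff exp_minus divide_inverse)
  also have "\<dots> \<le> 2 * exp (- a)" using assms(3) by simp
  finally show ?thesis unfolding t .
qed

lemma two_exp_minus_le: "x > 0 \<Longrightarrow> y \<ge> 2 * x \<Longrightarrow> 2 * exp (- y) \<le> 1 / (x::real)"
proof -
  assume "x > 0" "y \<ge> 2 * x"
  then have "2 * x \<le> exp y" using exp_ge_add_one_self[of y] by linarith
  then show ?thesis using \<open>x > 0\<close> by (simp add: exp_minus field_simps)
qed

lemma greedy_failure_le: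
  fixes r l D K m :: nat
  assumes "ln ((real r)\<^sup>2 + 1) \<le> l" "D \<ge> 1" "m \<ge> 1" "K \<ge> 4"
  shows "real ((r\<^sup>2 + 1) ^ (m * (K + 1))) *
    (2 * exp (- 2 * real (D\<^sup>2 * (m * (K + 1) * (2 + l))) * (1 / real D)\<^sup>2)) \<le> 1 / 6"
proof -
  define x where "x = m * (K + 1)"
  \<comment> \<open>With \<open>x \<ge> 5\<close> the surplus \<open>4 * x\<close> covers the 12
    that brings the failure probability down to \<open>1 / 6\<close>.\<close>
  have "1 * 5 \<le> x" unfolding x_def using assms by (intro mult_le_mono) auto
  then have "l * x + 12 \<le> 2 * (x * (2 + l))" by (simp add: algebra_simps)
  then have "real (l * x + 12) \<le> real (2 * (x * (2 + l)))" by (rule of_nat_mono)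
  then have "real l * real x + 12 \<le> 2 * real (x * (2 + l))" by simp
  from union_bound_le[OF assms(1) _ this, of D] two_exp_minus_le[of 6 12] assms(2)
  show ?thesis unfolding x_def[symmetric] by simp
qed

lemma block_failure_le:
  fixes r l D G :: nat
  assumes "ln ((real r)\<^sup>2 + 1) \<le> l" "D \<ge> 1"
  shows "real ((r\<^sup>2 + 1) ^ G) * (2 * exp (- 2 * real (D\<^sup>2 * (D + G * l)) * (1 / real D)\<^sup>2)) \<le> 1 / D"
proof -
  have "real l * real G + 2 * D \<le> 2 * real (D + G * l)" by simp
  from union_bound_le[OF assms(1) _ this, of D] two_exp_minus_le[of D "2 * D"] assms(2)
  show ?thesis by simp
qed

lemma average_failure_le:
  fixes D K :: nat
  assumes "D \<ge> 1" "K \<ge> 1"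
  shows "real K * (2 * exp (- 2 * real (D\<^sup>2 * (6 * K)) * (1 / real D)\<^sup>2)) \<le> 1 / 6"
proof -
  have t: "- 2 * real (D\<^sup>2 * (6 * K)) * (1 / real D)\<^sup>2 = - (12 * real K)"
    using assms(1) by (simp add: power_divide)
  have "2 * exp (- (12 * real K)) \<le> 1 / (6 * real K)"
    using assms by (intro two_exp_minus_le) auto
  then have "real K * (2 * exp (- (12 * real K))) \<le> real K * (1 / (6 * real K))"
    by (rule mult_left_mono) simp
  then show ?thesis unfolding t using assms by simp
qed

text \<open>The choice of \<open>R\<close> balances two errors: mixed fine cells cost at most
  \<open>m * b / D \<le> 2 * n / D\<close>, and crowded columns at most
  \<open>b * m / (2 * D) \<le> n / D\<close>.\<close>

lemma block_error:
  fixes n m b r D R :: nat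
  assumes "m \<ge> 1" "D \<ge> 1" "r \<le> m\<^sup>2" "m * b \<le> 2 * n" and R: "R = 2 * m * D"
  shows "m * R * (b div (R * D)) + b * r / R \<le> 3 * (1 / D) * n"
proof -
  have "b div (R * D) * (R * D) \<le> b" by (rule div_times_less_eq_dividend)
  then have "m * (b div (R * D) * (R * D)) \<le> m * b" by (rule mult_le_mono2)
  moreover have "m * R * (b div (R * D)) * D = m * (b div (R * D) * (R * D))"
    by (simp only: mult_ac)
  ultimately have "m * R * (b div (R * D)) * D \<le> 2 * n" using assms(4) by linarith
  then have "real (m * R * (b div (R * D)) * D) \<le> real (2 * n)" by (rule of_nat_mono)
  then have 1: "real (m * R * (b div (R * D))) \<le> 2 * n / D" using assms(2) by (simp add: pos_le_divide_eq)
  have "b * r * D \<le> b * m\<^sup>2 * D" using assms by simp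
  also have "\<dots> = (m * b) * (m * D)" by (simp add: power2_eq_square)
  also have "\<dots> \<le> (2 * n) * (m * D)" using assms(4) by (rule mult_le_mono1)
  also have "\<dots> = n * R" by (simp add: R)
  finally have "real (b * r * D) \<le> real (n * R)" by (rule of_nat_mono)
  then have "b * r / R \<le> n / D" using assms by (simp add: field_simps)
  with 1 show ?thesis by simp
qed

text \<open>The column samples dominate. Their three factors \<open>D\<^sup>2\<close> stem from the
  accuracy of the average, the accuracy within a column, and the number of fine cells. The constant
  is 5 for the greedy samples plus 96 for these.\<close>

lemma query_count:
  fixes N m D l :: nat
  assumes "N \<ge> 1" "m \<ge> 1" "D \<ge> 1"
  shows "D\<^sup>2 * (m * (4 * N + 1) * (2 + l)) + D\<^sup>2 * (6 * (4 * N)) * (D\<^sup>2 * (D + (2 * m * D * D + 2) * l))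
    \<le> 101 * N * m * D ^ 6 * (2 + l)"
proof -
  have "D\<^sup>2 \<le> D ^ 6" using assms by (intro power_increasing) auto
  then have 1: "D\<^sup>2 * (m * (4 * N + 1) * (2 + l)) \<le> D ^ 6 * (m * (5 * N) * (2 + l))"
    using assms by (intro mult_le_mono order_refl) auto
  have *: "D \<le> m * D\<^sup>2" "1 \<le> m * D\<^sup>2" using assms by (auto simp: power2_eq_square)
  then have "2 * m * D * D + 2 \<le> 4 * (m * D\<^sup>2)" by (simp add: power2_eq_square)
  then have "(2 * m * D * D + 2) * l \<le> 4 * (m * D\<^sup>2) * l" by (rule mult_le_mono1)
  with * have "D + (2 * m * D * D + 2) * l \<le> 4 * (m * D\<^sup>2) * (2 + l)" by (simp only: distrib_left)
  then have "D\<^sup>2 * (6 * (4 * N)) * (D\<^sup>2 * (D + (2 * m * D * D + 2) * l))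
      \<le> D\<^sup>2 * (6 * (4 * N)) * (D\<^sup>2 * (4 * (m * D\<^sup>2) * (2 + l)))"
    by (intro mult_le_mono2)
  also have "\<dots> = 96 * N * m * (D\<^sup>2 * D\<^sup>2 * D\<^sup>2) * (2 + l)" by (simp only: mult_ac)
  also have "D\<^sup>2 * D\<^sup>2 * D\<^sup>2 = D ^ 6" by (simp flip: power_add)
  finally show ?thesis using 1 by (simp add: algebra_simps)
qed

text \<open>All accuracies are \<open>1 / D\<close>. The algorithm is fixed before \<open>k\<close>
  is quantified, so the analysis may choose \<open>k\<close> according to the true LIS.\<close>

lemma grid_algorithm:
  fixes n r N m l D :: nat
  assumes "n \<ge> 1" "N \<ge> 1" "D \<ge> 1" and m: "1 \<le> m" "m \<le> n" "r \<le> m\<^sup>2"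
    and l: "ln ((real r)\<^sup>2 + 1) \<le> l"
  shows "\<exists>M::nonadaptive_alg. (\<forall>Dt\<in>set_pmf M. set (queries Dt) \<subseteq> {1..n} \<and>
      length (queries Dt) \<le> 101 * N * m * D ^ 6 * (2 + l)) \<and>
    (\<forall>A k. card (A ` {1..n}) \<le> r \<and> 1 \<le> k \<and> k \<le> 4 * N \<longrightarrow>
       measure_pmf.prob M {Dt. (LIS n A - n / real k - n / real D) / k - 6 * n / real D \<le> run Dt A
           \<and> run Dt A \<le> LIS n A + 6 * n / real D} \<ge> 2 / 3)"
proof -
  define R where "R = 2 * m * D"
  \<comment> \<open>The extra 1 gives \<open>n < m * b\<close>, so the positions up to
    \<open>n\<close> fit into \<open>m\<close> columns; \<open>m \<le> n\<close> keeps
    \<open>m * b\<close> at most \<open>2 * n\<close>.\<close>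
  define b where "b = n div m + 1"
  \<comment> \<open>Fine cells have at most \<open>Suc c\<close> positions. In short columns
    \<open>c\<close> is 0, and single-point cells cause no mixing error.\<close>
  define c where "c = b div (R * D)"
  define G where "G = R * D + 2"
  define K where "K = 4 * N"
  define q where "q = D\<^sup>2 * (m * (K + 1) * (2 + l))"
  define s where "s = D\<^sup>2 * (D + G * l)"
  define T where "T = D\<^sup>2 * (6 * K)"
  define P where "P = {1..n}"
  define g where "g = (\<lambda>p. p div b)"
  define h where "h = (\<lambda>p. p div Suc c)"
  define M where "M = lis_alg P g h q K T s"
  have R0: "R > 0" using \<open>D \<ge> 1\<close> m by (simp add: R_def)
  have P: "finite P" "P \<noteq> {}" "card P = n" using \<open>n \<ge> 1\<close> by (auto simp: P_def)
  have pos: "q > 0" "s > 0" "T > 0" "b > 0"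
    using \<open>D \<ge> 1\<close> m \<open>N \<ge> 1\<close> by (auto simp: q_def s_def T_def K_def b_def)
  have bm: "m * b \<le> 2 * n"
    using m(2) times_div_less_eq_dividend[of m n] unfolding b_def distrib_left by linarith
  have "n < m * b" using dividend_less_times_div[of m n] m(1) by (simp add: b_def add.commute)
  then have gP: "g ` P \<subseteq> {..<m}"
    using pos(4) by (auto simp: g_def P_def div_less_iff_less_mult)
  have mono: "mono g" "mono h" by (auto simp: g_def h_def mono_def div_le_mono)
  have fib: "card (P \<inter> g -` {i}) \<le> b" "card (P \<inter> h -` {i}) \<le> Suc c" for i
    using card_vimage_div[OF pos(4), of P i] card_vimage_div[of "Suc c" P i] by (auto simp: g_def h_def)
  have "b < R * D * Suc c"
    using dividend_less_times_div[of "R * D" b] R0 \<open>D \<ge> 1\<close> by (simp add: c_def add.commute)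
  then have "b div Suc c < R * D" by (simp add: div_less_iff_less_mult)
  then have cells: "card (h ` (P \<inter> g -` {i})) \<le> G" for i
    using card_image_div[OF pos(4), of "Suc c" P i] by (simp add: g_def h_def G_def)
  have err: "m * R * c + b * r / R \<le> 3 * (1 / D) * card P"
    unfolding c_def P(3) by (rule block_error[OF m(1) \<open>D \<ge> 1\<close> m(3) bm R_def])
  have dq: "real ((r\<^sup>2 + 1) ^ (m * (K + 1))) * (2 * exp (- 2 * real q * (1 / real D)\<^sup>2)) \<le> 1 / 6"
    unfolding q_def using l m(1) \<open>D \<ge> 1\<close> \<open>N \<ge> 1\<close> by (intro greedy_failure_le) (auto simp: K_def)
  have ds: "real ((r\<^sup>2 + 1) ^ G) * (2 * exp (- 2 * real s * (1 / real D)\<^sup>2)) \<le> 1 / D"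
    unfolding s_def by (rule block_failure_le[OF l \<open>D \<ge> 1\<close>])
  have dT: "real K * (2 * exp (- 2 * real T * (1 / real D)\<^sup>2)) \<le> 1 / 6"
    unfolding T_def using \<open>D \<ge> 1\<close> \<open>N \<ge> 1\<close> by (intro average_failure_le) (auto simp: K_def)
  have len: "q + T * s \<le> 101 * N * m * D ^ 6 * (2 + l)"
    unfolding q_def T_def s_def G_def R_def K_def
    by (rule query_count[OF \<open>N \<ge> 1\<close> m(1) \<open>D \<ge> 1\<close>])
  show ?thesis
  proof (intro exI[of _ M] conjI ballI allI impI)
    fix Dt assume "Dt \<in> set_pmf M"
    then show "set (queries Dt) \<subseteq> {1..n}" "length (queries Dt) \<le> 101 * N * m * D ^ 6 * (2 + l)"
      using lis_alg_queries[OF P(1,2)] len unfolding M_def P_def[symmetric] by auto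
  next
    fix A :: "nat \<Rightarrow> real" and k
    assume Ak: "card (A ` {1..n}) \<le> r \<and> 1 \<le> k \<and> k \<le> 4 * N"
    then have A: "card (A ` P) \<le> r" and k: "k > 0" "k \<le> K" by (auto simp: P_def K_def)
    have D0: "1 / real D \<ge> 0" by simp
    have LIS: "LIS n A = lis P A" by (simp add: LIS_eq_lis P_def)
    \<comment> \<open>Each of the two stages fails with probability at most \<open>1 / 6\<close>,
      and \<open>25 / 36\<close> exceeds \<open>2 / 3\<close>.\<close>
    have "(1 - 1 / 6) * (1 - 1 / 6) \<le> measure_pmf.prob
     (Pi_pmf {..<q} 0 (\<lambda>_. pmf_of_set P) \<bind>
       (\<lambda>x. map_pmf (Pair x) (Pi_pmf {..<T} (0, \<lambda>_. 0) (\<lambda>_. block_sample P g s))))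
      {(x, z). (lis P A - card P / real k - 1 / real D * card P) / k - 6 * (1 / real D) * card P
         \<le> estimate P g h q K T s x z A
        \<and> estimate P g h q K T s x z A \<le> lis P A + 6 * (1 / real D) * card P}"
      by (rule estimate_correct[OF P(1,2) mono(1) gP fib(1) mono(2) fib(2) cells A R0 pos(2,1,3) k(1) D0 k(2) dq ds dT _ _ err]) auto
    also have "{(x, z). (lis P A - card P / real k - 1 / real D * card P) / k - 6 * (1 / real D) * card P
         \<le> estimate P g h q K T s x z A
        \<and> estimate P g h q K T s x z A \<le> lis P A + 6 * (1 / real D) * card P}
       = (\<lambda>(x, z). lis_det P g h q K T s x z) -`
       {Dt. (LIS n A - n / real k - n / real D) / k - 6 * n / real D \<le> run Dt A
           \<and> run Dt A \<le> LIS n A + 6 * n / real D}"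
      by (auto simp: run_lis_det LIS P(3))
    finally show "measure_pmf.prob M {Dt. (LIS n A - n / real k - n / real D) / k - 6 * n / real D \<le> run Dt A
           \<and> run Dt A \<le> LIS n A + 6 * n / real D} \<ge> 2 / 3"
      by (simp add: M_def lis_alg_def)
  qed
qed

section \<open>Choice of parameters and final constants\<close>

text \<open>As \<open>k \<ge> 4 / lam\<close>, the loss \<open>n / k\<close> is at most a quarter of
  the LIS, and \<open>lam * n / 2\<close> survives. Dividing by \<open>k \<le> 5 / lam\<close>
  leaves \<open>lam\<^sup>2 * n / 10\<close>. The factor 120 makes \<open>6 * e\<close> at most half
  of this.\<close>

lemma approximation_arith:
  fixes lam0 lam :: real and N n k :: nat
  assumes "0 < lam0" "lam0 \<le> lam" "lam \<le> 1" "1 / lam0 \<le> N" "4 / lam \<le> k" "k \<le> 4 / lam + 1"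
  defines "e \<equiv> n / real (120 * N\<^sup>2)"
  shows "1 / 20 * (lam * (lam * n)) \<le> (lam * n - n / real k - e) / k - 6 * e"
    and "lam * n + 6 * e \<le> 2 * (lam * n)"
proof -
  have lam: "lam > 0" using assms by linarith
  have k0: "real k > 0" using assms(5) lam by (smt (verit) divide_pos_pos)
  have "1 / N \<le> lam0"
  proof -
    have "N > 0" using assms(1,4) by (smt (verit) divide_pos_pos of_nat_0 gr0I)
    then show ?thesis using assms(1,4) by (simp add: field_simps)
  qed
  then have "1 / N \<le> lam" using assms(2) by linarith
  then have "(1 / N)\<^sup>2 \<le> lam\<^sup>2" by (intro power_mono) auto
  then have "n / 120 * (1 / N)\<^sup>2 \<le> n / 120 * lam\<^sup>2" by (intro mult_left_mono) auto
  then have e: "e \<le> lam * (lam * n) / 120" by (simp add: e_def power_divide power2_eq_square mult_ac)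
  have ll: "lam * (lam * n) \<le> lam * n" "0 \<le> lam * n"
    using lam assms(3) by (simp_all add: mult_left_le_one_le)
  show "lam * n + 6 * e \<le> 2 * (lam * n)" using e ll by linarith
  have "1 / real k \<le> lam / 4" using assms(5) lam k0 by (simp add: field_simps)
  then have "n * (1 / real k) \<le> n * (lam / 4)" by (intro mult_left_mono) auto
  then have "n / real k \<le> lam * n / 4" by (simp add: mult.commute)
  then have "lam * n / 2 \<le> lam * n - n / real k - e" using e ll by linarith
  then have f1: "(lam * n / 2) * (1 / k) \<le> (lam * n - n / real k - e) * (1 / k)"
    by (intro mult_right_mono) auto
  have "lam / 5 \<le> 1 / real k"
  proof -
    have "real k \<le> 5 / lam" using assms(3,6) lam by (simp add: field_simps)
    then show ?thesis using k0 lam by (simp add: field_simps)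
  qed
  then have f2: "(lam * n / 2) * (lam / 5) \<le> (lam * n / 2) * (1 / k)"
    using ll by (intro mult_left_mono) auto
  have "lam * (lam * n) / 10 = (lam * n / 2) * (lam / 5)" by simp
  also note f2
  also note f1
  also have "(lam * n - n / real k - e) * (1 / k) = (lam * n - n / real k - e) / k" by simp
  finally show "1 / 20 * (lam * (lam * n)) \<le> (lam * n - n / real k - e) / k - 6 * e"
    using e by linarith
qed

text \<open>Since \<open>D\<close> is of order \<open>N\<^sup>2\<close>, the query bound contains
  \<open>N ^ 13\<close>. The factor \<open>2 ^ 13\<close> comes from rounding
  \<open>1 / lam0\<close> up, and 8 from rounding \<open>sqrt r'\<close> and from the
  logarithm.\<close>

lemma lis_approximation_algorithm:
  fixes n r :: nat and lam0 :: real
  assumes "n \<ge> 1" "r \<ge> 1" and lam0: "0 < lam0" "lam0 \<le> 1"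
  shows "\<exists>M::nonadaptive_alg. (\<forall>D\<in>set_pmf M. set (queries D) \<subseteq> {1..n} \<and>
      real (length (queries D)) \<le> soft_O (101 * 120 ^ 6 * 2 ^ 13 * 8) 1 (sqrt (real r) * (1 / lam0) ^ 13)) \<and>
    (\<forall>(A :: nat \<Rightarrow> real) (lam :: real). card (A ` {1..n}) \<le> r \<and> real (LIS n A) = lam * real n \<and> lam0 \<le> lam \<longrightarrow>
       measure_pmf.prob M
         {D. 1 / 20 * (lam * real (LIS n A)) \<le> run D A \<and> run D A \<le> 2 * real (LIS n A)} \<ge> 2 / 3)"
proof -
  \<comment> \<open>An array of length \<open>n\<close> has at most \<open>n\<close> values; the cap
    also keeps the number of columns at most \<open>n\<close>.\<close>
  define r' where "r' = min r n"
  define N where "N = nat \<lceil>1 / lam0\<rceil>"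
  define m where "m = nat \<lceil>sqrt r'\<rceil>"
  define l where "l = nat \<lceil>ln ((real r')\<^sup>2 + 1)\<rceil>"
  define D where "D = 120 * N\<^sup>2"
  have r': "1 \<le> r'" "r' \<le> n" "r' \<le> r" using assms by (auto simp: r'_def)
  have inv: "1 / lam0 \<ge> 1" using lam0 by simp
  have N: "1 / lam0 \<le> N" "N \<le> 2 * (1 / lam0)" "N \<ge> 1"
    using inv unfolding N_def by linarith+
  have sq: "sqrt r' \<ge> 1" using r' by simp
  have m: "sqrt r' \<le> m" "m \<le> 2 * sqrt r'" "m \<ge> 1"
    using sq unfolding m_def by linarith+
  have "sqrt r' \<le> n"
  proof -
    have "n * 1 \<le> n * n" using \<open>n \<ge> 1\<close> by (intro mult_le_mono2)
    then have "r' \<le> n\<^sup>2" using r'(2) unfolding power2_eq_square by linarith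
    then have "real r' \<le> (real n)\<^sup>2" by (metis of_nat_le_iff of_nat_power)
    then show ?thesis by (simp add: real_le_lsqrt)
  qed
  then have "m \<le> n" unfolding m_def by (simp add: ceiling_le_iff nat_le_iff)
  have "real r' \<le> (real m)\<^sup>2" using m(1) by (rule sqrt_le_D)
  then have "r' \<le> m\<^sup>2" by (metis of_nat_le_iff of_nat_power)
  have ln0: "ln ((real r')\<^sup>2 + 1) \<ge> 0" by simp
  have l: "ln ((real r')\<^sup>2 + 1) \<le> l" "l \<le> ln ((real r')\<^sup>2 + 1) + 1"
    using ln0 unfolding l_def by linarith+
  have D1: "D \<ge> 1" using N(3) by (simp add: D_def)
  obtain M :: nonadaptive_alg where M:
    "\<And>Dt. Dt \<in> set_pmf M \<Longrightarrow> set (queries Dt) \<subseteq> {1..n} \<and> length (queries Dt) \<le> 101 * N * m * D ^ 6 * (2 + l)"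
    "\<And>A k. card (A ` {1..n}) \<le> r' \<and> 1 \<le> k \<and> k \<le> 4 * N \<Longrightarrow>
       measure_pmf.prob M {Dt. (LIS n A - n / real k - n / real D) / k - 6 * n / real D \<le> run Dt A
           \<and> run Dt A \<le> LIS n A + 6 * n / real D} \<ge> 2 / 3"
    using grid_algorithm[OF \<open>n \<ge> 1\<close> N(3) D1 m(3) \<open>m \<le> n\<close> \<open>r' \<le> m\<^sup>2\<close> l(1)] by blast
  let ?x = "sqrt (real r) * (1 / lam0) ^ 13"
  have x: "sqrt r' \<le> sqrt r" "sqrt r \<le> ?x"
    using r' inv by (auto simp: mult_le_cancel_left1 one_le_power)
  \<comment> \<open>The logarithm of the square of \<open>r'\<close> is 4 times that of
    \<open>sqrt r'\<close>; the additive constants 2, 1 and \<open>ln 2\<close> fit into the other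
    4.\<close>
  have ell: "2 + real l \<le> 4 * (1 + ln ?x)"
  proof -
    have "ln ((real r')\<^sup>2 + 1) \<le> ln (2 * (real r')\<^sup>2)" using r' by (subst ln_le_cancel_iff) (auto simp: add_pos_nonneg)
    also have "\<dots> = ln 2 + 4 * ln (sqrt r')" using r' by (simp add: ln_mult ln_realpow ln_sqrt)
    also have "ln 2 \<le> (1::real)" using ln_2_less_1 by simp
    also have "ln (sqrt r') \<le> ln ?x"
    proof (subst ln_le_cancel_iff)
      show "0 < sqrt r'" "0 < ?x" "sqrt r' \<le> ?x" using x sq by linarith+
    qed
    finally show ?thesis using l(2) by simp
  qed
  have bound: "real (101 * N * m * D ^ 6 * (2 + l)) \<le> soft_O (101 * 120 ^ 6 * 2 ^ 13 * 8) 1 ?x"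
  proof -
    have D6: "real D ^ 6 = 120 ^ 6 * real N ^ 12"
      using power_mult[of "real N" 2 6] by (simp add: D_def power_mult_distrib)
    have N13: "real N ^ 13 = real N * real N ^ 12"
      using power_add[of "real N" 1 12] by simp
    have "real (101 * N * m * D ^ 6 * (2 + l)) = 101 * real N * real m * real D ^ 6 * (2 + real l)"
      by (simp only: of_nat_mult of_nat_add of_nat_power of_nat_numeral)
    also have "\<dots> = 101 * 120 ^ 6 * real N ^ 13 * real m * (2 + real l)"
      unfolding D6 N13 by simp
    also have "\<dots> \<le> 101 * 120 ^ 6 * (2 * (1 / lam0)) ^ 13 * (2 * sqrt r) * (4 * (1 + ln ?x))"
    proof -
      have "real m \<le> 2 * sqrt r" using m(2) x(1) by linarith
      then show ?thesis
        using N(2) ell lam0 by (intro mult_mono power_mono) auto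
    qed
    also have "\<dots> = soft_O (101 * 120 ^ 6 * 2 ^ 13 * 8) 1 ?x"
    proof -
      define y w where "y = (1 / lam0) ^ 13" and "w = 1 + ln ?x"
      have "(2 * (1 / lam0)) ^ 13 = 2 ^ 13 * y" unfolding y_def by (rule power_mult_distrib)
      then show ?thesis
        unfolding soft_O_def w_def[symmetric] y_def[symmetric] power_one_right by simp
    qed
    finally show ?thesis .
  qed
  show ?thesis
  proof (intro exI[of _ M] conjI ballI allI impI)
    fix Dt assume Dt: "Dt \<in> set_pmf M"
    show "set (queries Dt) \<subseteq> {1..n}" using M(1)[OF Dt] by simp
    have "real (length (queries Dt)) \<le> real (101 * N * m * D ^ 6 * (2 + l))"
      using M(1)[OF Dt] by (intro of_nat_mono) simp
    then show "real (length (queries Dt)) \<le> soft_O (101 * 120 ^ 6 * 2 ^ 13 * 8) 1 ?x"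
      using bound by linarith
  next
    fix A :: "nat \<Rightarrow> real" and lam :: real
    assume A: "card (A ` {1..n}) \<le> r \<and> real (LIS n A) = lam * real n \<and> lam0 \<le> lam"
    have lam: "0 < lam" "lam \<le> 1" "lam0 \<le> lam"
    proof -
      show "0 < lam" "lam0 \<le> lam" using A lam0 by auto
      have "LIS n A \<le> n" using lis_le_card[of "{1..n}" A] by (simp add: LIS_eq_lis)
      then have "lam * n \<le> 1 * n" using A by (metis mult_1 of_nat_le_iff)
      then show "lam \<le> 1" using \<open>n \<ge> 1\<close> by (simp add: mult_le_cancel_right)
    qed
    \<comment> \<open>This uses the true ratio, in the analysis only. As \<open>4 * N\<close> is an
      integer not below \<open>4 / lam\<close>, rounding up does not exceed it.\<close>
    define k where "k = nat \<lceil>4 / lam\<rceil>"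
    have four: "4 / lam \<ge> 4" using lam by (simp add: field_simps)
    have "4 / lam \<le> 4 / lam0" using lam lam0 by (intro divide_left_mono) auto
    then have "4 / lam \<le> real (4 * N)" using N(1) by simp
    then have k: "4 / lam \<le> k" "k \<le> 4 / lam + 1" "k \<le> 4 * N" "k \<ge> 1"
      using four unfolding k_def by linarith+
    have "card (A ` {1..n}) \<le> r'"
      using A card_image_le[of "{1..n}" A] by (simp add: r'_def)
    with k have pr: "2 / 3 \<le> measure_pmf.prob M {Dt. (LIS n A - n / real k - n / real D) / k - 6 * n / real D \<le> run Dt A
           \<and> run Dt A \<le> LIS n A + 6 * n / real D}" by (intro M(2)) auto
    have lower: "1 / 20 * (lam * real (LIS n A)) \<le> (LIS n A - n / real k - n / real D) / k - 6 * n / real D"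
      and upper: "LIS n A + 6 * n / real D \<le> 2 * real (LIS n A)"
      using approximation_arith[OF lam0(1) lam(3,2) N(1) k(1,2), of n] A by (simp_all add: D_def)
    have "measure_pmf.prob M {Dt. (LIS n A - n / real k - n / real D) / k - 6 * n / real D \<le> run Dt A
           \<and> run Dt A \<le> LIS n A + 6 * n / real D}
       \<le> measure_pmf.prob M {D. 1 / 20 * (lam * real (LIS n A)) \<le> run D A \<and> run D A \<le> 2 * real (LIS n A)}"
      using order_trans[OF lower] order_trans[OF _ upper]
      by (intro measure_pmf.finite_measure_mono Collect_mono) auto
    then show "2 / 3 \<le> measure_pmf.prob M
       {D. 1 / 20 * (lam * real (LIS n A)) \<le> run D A \<and> run D A \<le> 2 * real (LIS n A)}"
      using pr by linarith
  qed
qed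

theorem theorem1p5:
  shows "\<exists>(alg :: nat \<Rightarrow> nat \<Rightarrow> real \<Rightarrow> nonadaptive_alg) (c :: real) (C :: real) (K :: real) (d :: nat) (k :: nat).
    c > 0 \<and> C > 0 \<and> K > 0 \<and>
    (\<forall>(n :: nat) (r :: nat) (lam0 :: real). n \<ge> 1 \<and> r \<ge> 1 \<and> 0 < lam0 \<and> lam0 \<le> 1 \<longrightarrow>
      (\<forall>D \<in> set_pmf (alg n r lam0).
         set (queries D) \<subseteq> {1..n} \<and>
         real (length (queries D)) \<le> soft_O K k (sqrt (real r) * (1 / lam0) ^ d)) \<and>
      (\<forall>(A :: nat \<Rightarrow> real) (lam :: real).
         card (A ` {1..n}) \<le> r \<and> real (LIS n A) = lam * real n \<and> lam0 \<le> lam \<longrightarrow>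
         measure_pmf.prob (alg n r lam0)
           {D. c * (lam * real (LIS n A)) \<le> run D A \<and> run D A \<le> C * real (LIS n A)} \<ge> 2 / 3))"
proof -
  define Q where "Q n r lam0 M \<longleftrightarrow> (\<forall>D\<in>set_pmf M. set (queries D) \<subseteq> {1..n} \<and>
      real (length (queries D)) \<le> soft_O (101 * 120 ^ 6 * 2 ^ 13 * 8) 1 (sqrt (real r) * (1 / lam0) ^ 13)) \<and>
    (\<forall>(A :: nat \<Rightarrow> real) (lam :: real). card (A ` {1..n}) \<le> r \<and> real (LIS n A) = lam * real n \<and> lam0 \<le> lam \<longrightarrow>
       measure_pmf.prob M
         {D. 1 / 20 * (lam * real (LIS n A)) \<le> run D A \<and> run D A \<le> 2 * real (LIS n A)} \<ge> 2 / 3)"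
    for n r lam0 and M :: nonadaptive_alg
  \<comment> \<open>The constants are common to all inputs, so only the distribution is chosen
    separately for each \<open>n\<close>, \<open>r\<close> and \<open>lam0\<close>.\<close>
  define alg where "alg n r lam0 = (SOME M. Q n r lam0 M)" for n r lam0
  have "Q n r lam0 (alg n r lam0)" if "n \<ge> 1" "r \<ge> 1" "0 < lam0" "lam0 \<le> 1" for n r lam0
    using lis_approximation_algorithm[OF that] unfolding Q_def alg_def by (rule someI_ex)
  then have main: "\<forall>n r lam0. n \<ge> 1 \<and> r \<ge> 1 \<and> 0 < lam0 \<and> lam0 \<le> 1 \<longrightarrow> Q n r lam0 (alg n r lam0)"
    by blast
  have "(1 / 20 :: real) > 0" "(2 :: real) > 0" "(101 * 120 ^ 6 * 2 ^ 13 * 8 :: real) > 0"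
    by simp_all
  with main[unfolded Q_def] show ?thesis
    by blast
qed

end
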